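(* Let $R$ be a unital semisimple $f$MV-algebra and $P$ a unital semisimple PMV-algebra. Then the semisimple tensor product $R\otimes P$ is a unital semisimple $f$MV-algebra.
   Context: $[0,1]$ is the standard MV-algebra ($x\oplus y=\min(1,x+y)$, $x^*=1-x$). The partial sum $x+y$ in an MV-algebra is defined iff $x\le y^*$ and then equals $x\oplus y$; bilinear means linear in each argument with respect to it. A unital PMV-algebra is an MV-algebra with a bilinear associative product $\cdot$ with unit $1=0^*$. A Riesz MV-algebra is an MV-algebra with a bilinear scalar multiplication $[0,1]\times M\to M$ satisfying $(\alpha\beta)x=\alpha(\beta x)$, $1x=x$. A unital $f$MV-algebra is a structure that is simultaneously a unital PMV-algebra and a Riesz MV-algebra (same MV-reduct) with $\alpha(x\cdot y)=(\alpha x)\cdot y=x\cdot(\alpha y)$. Semisimple: the MV-reduct is isomorphic to a separating MV-algebra of continuous $[0,1]$-valued functions on a compact Hausdorff space. For semisimple MV-algebras $A,B$, $A\otimes B=(A\otimes_{MV}B)/\mathrm{Rad}(A\otimes_{MV}B)$ is the semisimple tensor product, $\otimes_{MV}$ being universal for bimorphisms (maps linear and $\vee,\wedge$-preserving in each argument); equivalently, for $A\subseteq C(X)$, $B\subseteq C(Y)$, the MV-subalgebra of $C(X\times Y)$ generated by $(x,y)\mapsto a(x)b(y)$. *)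

theory Defs
  imports "HOL-Analysis.Analysis" "HOL-Algebra.Congruence"
begin

section \<open>MV-algebras\<close>

record 'a mv = "'a partial_object" +
  mv_add :: "'a \<Rightarrow> 'a \<Rightarrow> 'a" (infixl "\<boxplus>\<index>" 65)
  mv_neg :: "'a \<Rightarrow> 'a" ("\<sim>\<index> _" [81] 80)
  mv_zero :: "'a" ("\<^bold>0\<index>")

locale mv_algebra =
  fixes M :: "('a, 'm) mv_scheme" (structure)
  assumes add_closed: "\<lbrakk>x \<in> carrier M; y \<in> carrier M\<rbrakk> \<Longrightarrow> x \<boxplus> y \<in> carrier M"
    and neg_closed: "x \<in> carrier M \<Longrightarrow> \<sim> x \<in> carrier M"
    and zero_closed: "\<^bold>0 \<in> carrier M"
    and add_assoc: "\<lbrakk>x \<in> carrier M; y \<in> carrier M; z \<in> carrier M\<rbrakk> \<Longrightarrow> (x \<boxplus> y) \<boxplus> z = x \<boxplus> (y \<boxplus> z)"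
    and add_comm: "\<lbrakk>x \<in> carrier M; y \<in> carrier M\<rbrakk> \<Longrightarrow> x \<boxplus> y = y \<boxplus> x"
    and add_zero: "x \<in> carrier M \<Longrightarrow> x \<boxplus> \<^bold>0 = x"
    and neg_neg: "x \<in> carrier M \<Longrightarrow> \<sim> (\<sim> x) = x"
    and add_neg_zero: "x \<in> carrier M \<Longrightarrow> x \<boxplus> \<sim> \<^bold>0 = \<sim> \<^bold>0"
    and lukasiewicz: "\<lbrakk>x \<in> carrier M; y \<in> carrier M\<rbrakk>
      \<Longrightarrow> \<sim> (\<sim> x \<boxplus> y) \<boxplus> y = \<sim> (\<sim> y \<boxplus> x) \<boxplus> x"

definition mv_one :: "('a, 'm) mv_scheme \<Rightarrow> 'a" ("\<^bold>1\<index>")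
  where "\<^bold>1\<^bsub>M\<^esub> = \<sim>\<^bsub>M\<^esub> \<^bold>0\<^bsub>M\<^esub>"

definition mv_le :: "('a, 'm) mv_scheme \<Rightarrow> 'a \<Rightarrow> 'a \<Rightarrow> bool" (infix "\<preceq>\<index>" 50)
  where "x \<preceq>\<^bsub>M\<^esub> y \<longleftrightarrow> \<sim>\<^bsub>M\<^esub> x \<boxplus>\<^bsub>M\<^esub> y = \<^bold>1\<^bsub>M\<^esub>"

definition mv_join :: "('a, 'm) mv_scheme \<Rightarrow> 'a \<Rightarrow> 'a \<Rightarrow> 'a"
  where "mv_join M x y = \<sim>\<^bsub>M\<^esub> (\<sim>\<^bsub>M\<^esub> x \<boxplus>\<^bsub>M\<^esub> y) \<boxplus>\<^bsub>M\<^esub> y"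

definition mv_meet :: "('a, 'm) mv_scheme \<Rightarrow> 'a \<Rightarrow> 'a \<Rightarrow> 'a"
  where "mv_meet M x y = \<sim>\<^bsub>M\<^esub> (mv_join M (\<sim>\<^bsub>M\<^esub> x) (\<sim>\<^bsub>M\<^esub> y))"

definition mv_diff :: "('a, 'm) mv_scheme \<Rightarrow> 'a \<Rightarrow> 'a \<Rightarrow> 'a"
  where "mv_diff M x y = \<sim>\<^bsub>M\<^esub> (\<sim>\<^bsub>M\<^esub> x \<boxplus>\<^bsub>M\<^esub> y)"

definition mv_hom :: "('a, 'm) mv_scheme \<Rightarrow> ('b, 'n) mv_scheme \<Rightarrow> ('a \<Rightarrow> 'b) set"
  where "mv_hom A B = {h \<in> carrier A \<rightarrow> carrier B.
    (\<forall>x\<in>carrier A. \<forall>y\<in>carrier A. h (x \<boxplus>\<^bsub>A\<^esub> y) = h x \<boxplus>\<^bsub>B\<^esub> h y) \<and>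
    (\<forall>x\<in>carrier A. h (\<sim>\<^bsub>A\<^esub> x) = \<sim>\<^bsub>B\<^esub> (h x)) \<and>
    h \<^bold>0\<^bsub>A\<^esub> = \<^bold>0\<^bsub>B\<^esub>}"

definition mv_subalgebra :: "'a set \<Rightarrow> ('a, 'm) mv_scheme \<Rightarrow> bool"
  where "mv_subalgebra S M \<longleftrightarrow> S \<subseteq> carrier M \<and> \<^bold>0\<^bsub>M\<^esub> \<in> S \<and>
    (\<forall>x\<in>S. \<sim>\<^bsub>M\<^esub> x \<in> S) \<and> (\<forall>x\<in>S. \<forall>y\<in>S. x \<boxplus>\<^bsub>M\<^esub> y \<in> S)"

definition unit_interval_mv :: "real mv"
  where "unit_interval_mv =
    \<lparr>carrier = {0..1}, mv_add = (\<lambda>x y. min 1 (x + y)), mv_neg = (\<lambda>x. 1 - x), mv_zero = 0\<rparr>"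

section \<open>Linear and bilinear maps\<close>

text \<open>The partial sum of \<open>x\<close> and \<open>y\<close> is defined iff \<open>x \<preceq> \<sim> y\<close>; a linear map preserves both its
  definedness and its value.\<close>

definition mv_linear :: "('a, 'm) mv_scheme \<Rightarrow> ('b, 'n) mv_scheme \<Rightarrow> ('a \<Rightarrow> 'b) \<Rightarrow> bool"
  where "mv_linear A B f \<longleftrightarrow> f \<in> carrier A \<rightarrow> carrier B \<and>
    (\<forall>x\<in>carrier A. \<forall>y\<in>carrier A. x \<preceq>\<^bsub>A\<^esub> \<sim>\<^bsub>A\<^esub> y \<longrightarrow>
       f x \<preceq>\<^bsub>B\<^esub> \<sim>\<^bsub>B\<^esub> (f y) \<and> f (x \<boxplus>\<^bsub>A\<^esub> y) = f x \<boxplus>\<^bsub>B\<^esub> f y)"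

definition mv_bilinear ::
    "('a, 'm) mv_scheme \<Rightarrow> ('b, 'n) mv_scheme \<Rightarrow> ('c, 'k) mv_scheme \<Rightarrow> ('a \<Rightarrow> 'b \<Rightarrow> 'c) \<Rightarrow> bool"
  where "mv_bilinear A B C f \<longleftrightarrow>
    (\<forall>a\<in>carrier A. mv_linear B C (f a)) \<and>
    (\<forall>b\<in>carrier B. mv_linear A C (\<lambda>a. f a b))"

section \<open>PMV-algebras, Riesz MV-algebras and fMV-algebras\<close>

locale unital_pmv_algebra = mv_algebra M
  for M :: "('a, 'm) mv_scheme" (structure) +
  fixes mult :: "'a \<Rightarrow> 'a \<Rightarrow> 'a"
  assumes mult_bilinear: "mv_bilinear M M M mult"
    and mult_assoc: "\<lbrakk>x \<in> carrier M; y \<in> carrier M; z \<in> carrier M\<rbrakk>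
      \<Longrightarrow> mult (mult x y) z = mult x (mult y z)"
    and mult_one_left: "x \<in> carrier M \<Longrightarrow> mult \<^bold>1 x = x"
    and mult_one_right: "x \<in> carrier M \<Longrightarrow> mult x \<^bold>1 = x"

locale riesz_mv_algebra = mv_algebra M
  for M :: "('a, 'm) mv_scheme" (structure) +
  fixes scal :: "real \<Rightarrow> 'a \<Rightarrow> 'a"
  assumes scal_bilinear: "mv_bilinear unit_interval_mv M M scal"
    and scal_assoc: "\<lbrakk>\<alpha> \<in> {0..1}; \<beta> \<in> {0..1}; x \<in> carrier M\<rbrakk>
      \<Longrightarrow> scal (\<alpha> * \<beta>) x = scal \<alpha> (scal \<beta> x)"
    and scal_one: "x \<in> carrier M \<Longrightarrow> scal 1 x = x"

locale unital_fmv_algebra = unital_pmv_algebra M mult + riesz_mv_algebra M scal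
  for M :: "('a, 'm) mv_scheme" (structure)
    and mult :: "'a \<Rightarrow> 'a \<Rightarrow> 'a" and scal :: "real \<Rightarrow> 'a \<Rightarrow> 'a" +
  assumes scal_mult_left: "\<lbrakk>\<alpha> \<in> {0..1}; x \<in> carrier M; y \<in> carrier M\<rbrakk>
      \<Longrightarrow> scal \<alpha> (mult x y) = mult (scal \<alpha> x) y"
    and scal_mult_right: "\<lbrakk>\<alpha> \<in> {0..1}; x \<in> carrier M; y \<in> carrier M\<rbrakk>
      \<Longrightarrow> scal \<alpha> (mult x y) = mult x (scal \<alpha> y)"

section \<open>Semisimple MV-algebras\<close>

definition cont_mv :: "'x topology \<Rightarrow> ('x \<Rightarrow> real) mv"
  where "cont_mv X =
    \<lparr>carrier = {f \<in> topspace X \<rightarrow>\<^sub>E {0..1}. continuous_map X euclideanreal f},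
     mv_add = (\<lambda>f g. \<lambda>x\<in>topspace X. f x \<boxplus>\<^bsub>unit_interval_mv\<^esub> g x),
     mv_neg = (\<lambda>f. \<lambda>x\<in>topspace X. \<sim>\<^bsub>unit_interval_mv\<^esub> (f x)),
     mv_zero = (\<lambda>x\<in>topspace X. \<^bold>0\<^bsub>unit_interval_mv\<^esub>)\<rparr>"

text \<open>Fixing the type \<open>'a \<Rightarrow> real\<close> for the points of the space loses no generality: if \<open>h\<close> represents
  \<open>A\<close> by a separating algebra of functions on a space \<open>Y\<close>, then \<open>\<lambda>y a. h a y\<close> (with arguments outside
  \<open>carrier A\<close> sent to \<open>0\<close>) is injective on \<open>Y\<close>, so \<open>Y\<close> can be transported to this type.\<close>

definition mv_semisimple :: "('a, 'm) mv_scheme \<Rightarrow> bool"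
  where "mv_semisimple A \<longleftrightarrow>
    (\<exists>(X :: ('a \<Rightarrow> real) topology) S h.
       compact_space X \<and> Hausdorff_space X \<and>
       mv_subalgebra S (cont_mv X) \<and>
       (\<forall>x\<in>topspace X. \<forall>y\<in>topspace X. x \<noteq> y \<longrightarrow> (\<exists>f\<in>S. f x \<noteq> f y)) \<and>
       h \<in> mv_hom A ((cont_mv X)\<lparr>carrier := S\<rparr>) \<and> bij_betw h (carrier A) S)"

section \<open>Congruences, ideals and the radical\<close>

definition mv_congruence :: "('a, 'm) mv_scheme \<Rightarrow> ('a \<times> 'a) set \<Rightarrow> bool"
  where "mv_congruence M \<theta> \<longleftrightarrow> equiv (carrier M) \<theta> \<and>
    (\<forall>x x'. (x, x') \<in> \<theta> \<longrightarrow> (\<sim>\<^bsub>M\<^esub> x, \<sim>\<^bsub>M\<^esub> x') \<in> \<theta>) \<and>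
    (\<forall>x x' y y'. (x, x') \<in> \<theta> \<longrightarrow> (y, y') \<in> \<theta> \<longrightarrow> (x \<boxplus>\<^bsub>M\<^esub> y, x' \<boxplus>\<^bsub>M\<^esub> y') \<in> \<theta>)"

text \<open>When \<open>\<theta>\<close> is a congruence, each union below is that of a constant nonempty family of classes.\<close>

definition mv_quot :: "('a, 'm) mv_scheme \<Rightarrow> ('a \<times> 'a) set \<Rightarrow> 'a set mv"
  where "mv_quot M \<theta> =
    \<lparr>carrier = carrier M // \<theta>,
     mv_add = (\<lambda>U V. \<Union>x\<in>U. \<Union>y\<in>V. \<theta> `` {x \<boxplus>\<^bsub>M\<^esub> y}),
     mv_neg = (\<lambda>U. \<Union>x\<in>U. \<theta> `` {\<sim>\<^bsub>M\<^esub> x}),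
     mv_zero = \<theta> `` {\<^bold>0\<^bsub>M\<^esub>}\<rparr>"

definition mv_ideal :: "('a, 'm) mv_scheme \<Rightarrow> 'a set \<Rightarrow> bool"
  where "mv_ideal M I \<longleftrightarrow> I \<subseteq> carrier M \<and> \<^bold>0\<^bsub>M\<^esub> \<in> I \<and>
    (\<forall>x\<in>I. \<forall>y\<in>I. x \<boxplus>\<^bsub>M\<^esub> y \<in> I) \<and>
    (\<forall>x\<in>I. \<forall>y\<in>carrier M. y \<preceq>\<^bsub>M\<^esub> x \<longrightarrow> y \<in> I)"

definition mv_maximal_ideal :: "('a, 'm) mv_scheme \<Rightarrow> 'a set \<Rightarrow> bool"
  where "mv_maximal_ideal M I \<longleftrightarrow> mv_ideal M I \<and> I \<noteq> carrier M \<and>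
    (\<forall>J. mv_ideal M J \<longrightarrow> I \<subseteq> J \<longrightarrow> J = I \<or> J = carrier M)"

definition mv_radical :: "('a, 'm) mv_scheme \<Rightarrow> 'a set"
  where "mv_radical M = {x \<in> carrier M. \<forall>I. mv_maximal_ideal M I \<longrightarrow> x \<in> I}"

definition mv_ideal_rel :: "('a, 'm) mv_scheme \<Rightarrow> 'a set \<Rightarrow> ('a \<times> 'a) set"
  where "mv_ideal_rel M I =
    {(x, y) \<in> carrier M \<times> carrier M. mv_diff M x y \<boxplus>\<^bsub>M\<^esub> mv_diff M y x \<in> I}"

section \<open>The tensor product\<close>

text \<open>The condition \<open>\<beta> \<^bold>1 \<^bold>1 = \<^bold>1\<close> is part of Mundici's notion of bimorphism. The value \<open>0\<close> whenever one
  argument is \<open>0\<close> follows from bilinearity.\<close>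

definition mv_bimorphism ::
    "('a, 'm) mv_scheme \<Rightarrow> ('b, 'n) mv_scheme \<Rightarrow> ('c, 'k) mv_scheme \<Rightarrow> ('a \<Rightarrow> 'b \<Rightarrow> 'c) \<Rightarrow> bool"
  where "mv_bimorphism A B C \<beta> \<longleftrightarrow> mv_bilinear A B C \<beta> \<and> \<beta> \<^bold>1\<^bsub>A\<^esub> \<^bold>1\<^bsub>B\<^esub> = \<^bold>1\<^bsub>C\<^esub> \<and>
    (\<forall>a\<in>carrier A. \<forall>b\<in>carrier B. \<forall>b'\<in>carrier B.
       \<beta> a (mv_join B b b') = mv_join C (\<beta> a b) (\<beta> a b') \<and>
       \<beta> a (mv_meet B b b') = mv_meet C (\<beta> a b) (\<beta> a b')) \<and>
    (\<forall>a\<in>carrier A. \<forall>a'\<in>carrier A. \<forall>b\<in>carrier B.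
       \<beta> (mv_join A a a') b = mv_join C (\<beta> a b) (\<beta> a' b) \<and>
       \<beta> (mv_meet A a a') b = mv_meet C (\<beta> a b) (\<beta> a' b))"

datatype 'g mv_term =
    Gen 'g
  | Zero_term
  | Neg_term "'g mv_term"
  | Add_term "'g mv_term" "'g mv_term"

definition mv_terms :: "'g set \<Rightarrow> 'g mv_term mv"
  where "mv_terms G =
    \<lparr>carrier = {t. set_mv_term t \<subseteq> G}, mv_add = Add_term, mv_neg = Neg_term, mv_zero = Zero_term\<rparr>"

text \<open>The universal recipient of a bimorphism on \<open>A \<times> B\<close> is built by generators and relations: MV-terms
  over the pairs \<open>(a, b)\<close> modulo the least congruence that makes the quotient an MV-algebra and
  \<open>(a, b) \<mapsto> [(a, b)]\<close> a bimorphism. Its universal property is proved below.\<close>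

definition mv_tensor_congs ::
    "('a, 'm) mv_scheme \<Rightarrow> ('b, 'n) mv_scheme \<Rightarrow> (('a \<times> 'b) mv_term \<times> ('a \<times> 'b) mv_term) set set"
  where "mv_tensor_congs A B = {\<theta>.
    mv_congruence (mv_terms (carrier A \<times> carrier B)) \<theta> \<and>
    mv_algebra (mv_quot (mv_terms (carrier A \<times> carrier B)) \<theta>) \<and>
    mv_bimorphism A B (mv_quot (mv_terms (carrier A \<times> carrier B)) \<theta>) (\<lambda>a b. \<theta> `` {Gen (a, b)})}"

definition mv_tensor_rel ::
    "('a, 'm) mv_scheme \<Rightarrow> ('b, 'n) mv_scheme \<Rightarrow> (('a \<times> 'b) mv_term \<times> ('a \<times> 'b) mv_term) set"
  where "mv_tensor_rel A B = \<Inter> (mv_tensor_congs A B)"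

definition mv_tensor ::
    "('a, 'm) mv_scheme \<Rightarrow> ('b, 'n) mv_scheme \<Rightarrow> ('a \<times> 'b) mv_term set mv"
  where "mv_tensor A B = mv_quot (mv_terms (carrier A \<times> carrier B)) (mv_tensor_rel A B)"

definition mv_tensor_pure ::
    "('a, 'm) mv_scheme \<Rightarrow> ('b, 'n) mv_scheme \<Rightarrow> 'a \<Rightarrow> 'b \<Rightarrow> ('a \<times> 'b) mv_term set"
  where "mv_tensor_pure A B a b = mv_tensor_rel A B `` {Gen (a, b)}"

definition ss_tensor ::
    "('a, 'm) mv_scheme \<Rightarrow> ('b, 'n) mv_scheme \<Rightarrow> ('a \<times> 'b) mv_term set set mv"
  where "ss_tensor A B =
    mv_quot (mv_tensor A B) (mv_ideal_rel (mv_tensor A B) (mv_radical (mv_tensor A B)))"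

definition ss_tensor_pure ::
    "('a, 'm) mv_scheme \<Rightarrow> ('b, 'n) mv_scheme \<Rightarrow> 'a \<Rightarrow> 'b \<Rightarrow> ('a \<times> 'b) mv_term set set"
  where "ss_tensor_pure A B a b =
    mv_ideal_rel (mv_tensor A B) (mv_radical (mv_tensor A B)) `` {mv_tensor_pure A B a b}"

section \<open>Universal property of the tensor product\<close>

lemma mv_quot_carrier: "carrier (mv_quot M \<theta>) = (\<lambda>x. \<theta> `` {x}) ` carrier M"
  by (auto simp: mv_quot_def quotient_def)

lemma mv_quot_zero: "\<^bold>0\<^bsub>mv_quot M \<theta>\<^esub> = \<theta> `` {\<^bold>0\<^bsub>M\<^esub>}"
  by (simp add: mv_quot_def)

lemma mv_quot_neg:
  assumes "mv_congruence M \<theta>" and x: "x \<in> carrier M"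
  shows "\<sim>\<^bsub>mv_quot M \<theta>\<^esub> (\<theta> `` {x}) = \<theta> `` {\<sim>\<^bsub>M\<^esub> x}"
proof -
  have eq: "equiv (carrier M) \<theta>"
    using assms by (simp add: mv_congruence_def)
  have c: "\<theta> `` {\<sim>\<^bsub>M\<^esub> u} = \<theta> `` {\<sim>\<^bsub>M\<^esub> x}" if "u \<in> \<theta> `` {x}" for u
    using that assms(1) by (intro equiv_class_eq[OF eq, symmetric]) (auto simp: mv_congruence_def)
  have "(\<Union>u\<in>\<theta> `` {x}. \<theta> `` {\<sim>\<^bsub>M\<^esub> u}) = \<theta> `` {\<sim>\<^bsub>M\<^esub> x}"
    by (rule UN_constant_eq[OF equiv_class_self[OF eq x]]) (simp add: c)
  then show ?thesis
    by (simp only: mv_quot_def mv.simps)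
qed

lemma mv_quot_add:
  assumes "mv_congruence M \<theta>" and x: "x \<in> carrier M" and y: "y \<in> carrier M"
  shows "(\<theta> `` {x}) \<boxplus>\<^bsub>mv_quot M \<theta>\<^esub> (\<theta> `` {y}) = \<theta> `` {x \<boxplus>\<^bsub>M\<^esub> y}"
proof -
  have eq: "equiv (carrier M) \<theta>"
    using assms by (simp add: mv_congruence_def)
  have c: "\<theta> `` {u \<boxplus>\<^bsub>M\<^esub> v} = \<theta> `` {x \<boxplus>\<^bsub>M\<^esub> y}" if "u \<in> \<theta> `` {x}" "v \<in> \<theta> `` {y}" for u v
    using that assms(1) by (intro equiv_class_eq[OF eq, symmetric]) (auto simp: mv_congruence_def)
  have "(\<Union>v\<in>\<theta> `` {y}. \<theta> `` {u \<boxplus>\<^bsub>M\<^esub> v}) = \<theta> `` {x \<boxplus>\<^bsub>M\<^esub> y}" if "u \<in> \<theta> `` {x}" for u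
    by (rule UN_constant_eq[OF equiv_class_self[OF eq y]]) (simp add: c[OF that])
  then have "(\<Union>u\<in>\<theta> `` {x}. \<Union>v\<in>\<theta> `` {y}. \<theta> `` {u \<boxplus>\<^bsub>M\<^esub> v}) = \<theta> `` {x \<boxplus>\<^bsub>M\<^esub> y}"
    by (intro UN_constant_eq[OF equiv_class_self[OF eq x]] ballI)
  then show ?thesis
    by (simp only: mv_quot_def mv.simps)
qed

lemma mv_quot_eq:
  assumes "mv_congruence M \<theta>" and "x \<in> carrier M" and "y \<in> carrier M"
  shows "\<theta> `` {x} = \<theta> `` {y} \<longleftrightarrow> (x, y) \<in> \<theta>"
  using assms Equiv_Relations.eq_equiv_class_iff[of "carrier M" \<theta> x y] by (simp add: mv_congruence_def)

lemma mv_terms_simps: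
  "Gen g \<in> carrier (mv_terms G) \<longleftrightarrow> g \<in> G"
  "Zero_term \<in> carrier (mv_terms G)"
  "Neg_term t \<in> carrier (mv_terms G) \<longleftrightarrow> t \<in> carrier (mv_terms G)"
  "Add_term s t \<in> carrier (mv_terms G) \<longleftrightarrow> s \<in> carrier (mv_terms G) \<and> t \<in> carrier (mv_terms G)"
  "s \<boxplus>\<^bsub>mv_terms G\<^esub> t = Add_term s t"
  "\<sim>\<^bsub>mv_terms G\<^esub> t = Neg_term t"
  "\<^bold>0\<^bsub>mv_terms G\<^esub> = Zero_term"
  by (auto simp: mv_terms_def)

lemma mv_terms_quot_algebra_iff:
  fixes G \<theta>
  defines "F \<equiv> carrier (mv_terms G)"
  assumes cong: "mv_congruence (mv_terms G) \<theta>"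
  shows "mv_algebra (mv_quot (mv_terms G) \<theta>) \<longleftrightarrow>
    (\<forall>x\<in>F. \<forall>y\<in>F. \<forall>z\<in>F. (Add_term (Add_term x y) z, Add_term x (Add_term y z)) \<in> \<theta>) \<and>
    (\<forall>x\<in>F. \<forall>y\<in>F. (Add_term x y, Add_term y x) \<in> \<theta>) \<and>
    (\<forall>x\<in>F. (Add_term x Zero_term, x) \<in> \<theta>) \<and>
    (\<forall>x\<in>F. (Neg_term (Neg_term x), x) \<in> \<theta>) \<and>
    (\<forall>x\<in>F. (Add_term x (Neg_term Zero_term), Neg_term Zero_term) \<in> \<theta>) \<and>
    (\<forall>x\<in>F. \<forall>y\<in>F. (Add_term (Neg_term (Add_term (Neg_term x) y)) y,
      Add_term (Neg_term (Add_term (Neg_term y) x)) x) \<in> \<theta>)"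
    (is "?L \<longleftrightarrow> ?R")
proof
  note S = mv_quot_zero mv_quot_neg[OF cong] mv_quot_add[OF cong] mv_quot_eq[OF cong] mv_terms_simps
  have cls: "\<theta> `` {t} \<in> carrier (mv_quot (mv_terms G) \<theta>)" if "t \<in> F" for t
    using that by (simp add: mv_quot_carrier F_def)
  show ?R if ?L
  proof -
    note E = mv_algebra.add_assoc[OF that cls cls cls] mv_algebra.add_comm[OF that cls cls]
      mv_algebra.add_zero[OF that cls] mv_algebra.neg_neg[OF that cls]
      mv_algebra.add_neg_zero[OF that cls] mv_algebra.lukasiewicz[OF that cls cls]
    show ?R
      using E unfolding F_def by (simp add: S)
  qed
  have im: "\<theta> `` {t} \<in> (\<lambda>x. \<theta> `` {x}) ` F" if "t \<in> F" for t
    using that by simp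
  show ?L if ?R
    using that im unfolding F_def mv_algebra_def mv_quot_carrier
    by (intro conjI allI impI; (elim imageE)?; simp add: S)
qed

lemma mv_terms_quot_bimorphism_iff:
  fixes A :: "('a, 'm) mv_scheme" and B :: "('b, 'n) mv_scheme" and \<theta>
  defines "F \<equiv> mv_terms (carrier A \<times> carrier B)"
  assumes A: "mv_algebra A" and B: "mv_algebra B" and cong: "mv_congruence F \<theta>"
  shows "mv_bimorphism A B (mv_quot F \<theta>) (\<lambda>a b. \<theta> `` {Gen (a, b)}) \<longleftrightarrow>
    (\<forall>a\<in>carrier A. \<forall>b\<in>carrier B. \<forall>b'\<in>carrier B. b \<preceq>\<^bsub>B\<^esub> \<sim>\<^bsub>B\<^esub> b' \<longrightarrow>
      (\<sim>\<^bsub>F\<^esub> Gen (a, b) \<boxplus>\<^bsub>F\<^esub> \<sim>\<^bsub>F\<^esub> Gen (a, b'), \<^bold>1\<^bsub>F\<^esub>) \<in> \<theta> \<and>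
      (Gen (a, b \<boxplus>\<^bsub>B\<^esub> b'), Gen (a, b) \<boxplus>\<^bsub>F\<^esub> Gen (a, b')) \<in> \<theta>) \<and>
    (\<forall>b\<in>carrier B. \<forall>a\<in>carrier A. \<forall>a'\<in>carrier A. a \<preceq>\<^bsub>A\<^esub> \<sim>\<^bsub>A\<^esub> a' \<longrightarrow>
      (\<sim>\<^bsub>F\<^esub> Gen (a, b) \<boxplus>\<^bsub>F\<^esub> \<sim>\<^bsub>F\<^esub> Gen (a', b), \<^bold>1\<^bsub>F\<^esub>) \<in> \<theta> \<and>
      (Gen (a \<boxplus>\<^bsub>A\<^esub> a', b), Gen (a, b) \<boxplus>\<^bsub>F\<^esub> Gen (a', b)) \<in> \<theta>) \<and>
    (Gen (\<^bold>1\<^bsub>A\<^esub>, \<^bold>1\<^bsub>B\<^esub>), \<^bold>1\<^bsub>F\<^esub>) \<in> \<theta> \<and>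
    (\<forall>a\<in>carrier A. \<forall>b\<in>carrier B. \<forall>b'\<in>carrier B.
      (Gen (a, mv_join B b b'), mv_join F (Gen (a, b)) (Gen (a, b'))) \<in> \<theta> \<and>
      (Gen (a, mv_meet B b b'), mv_meet F (Gen (a, b)) (Gen (a, b'))) \<in> \<theta>) \<and>
    (\<forall>a\<in>carrier A. \<forall>a'\<in>carrier A. \<forall>b\<in>carrier B.
      (Gen (mv_join A a a', b), mv_join F (Gen (a, b)) (Gen (a', b))) \<in> \<theta> \<and>
      (Gen (mv_meet A a a', b), mv_meet F (Gen (a, b)) (Gen (a', b))) \<in> \<theta>)"
proof -
  note S = mv_quot_zero mv_quot_neg[OF cong[unfolded F_def]] mv_quot_add[OF cong[unfolded F_def]]
    mv_quot_eq[OF cong[unfolded F_def]] mv_terms_simps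
  note CA = mv_algebra.add_closed[OF A] mv_algebra.neg_closed[OF A] mv_algebra.zero_closed[OF A]
  note CB = mv_algebra.add_closed[OF B] mv_algebra.neg_closed[OF B] mv_algebra.zero_closed[OF B]
  have Gen: "\<theta> `` {Gen (a, b)} \<in> carrier (mv_quot F \<theta>)" if "a \<in> carrier A" "b \<in> carrier B" for a b
    using that by (simp add: mv_quot_carrier F_def mv_terms_simps)
  show ?thesis
    using Gen unfolding F_def
    by (simp add: mv_bimorphism_def mv_bilinear_def mv_linear_def mv_le_def mv_one_def mv_join_def
        mv_meet_def S CA CB Pi_iff)
qed

fun mv_eval :: "('c, 'k) mv_scheme \<Rightarrow> ('g \<Rightarrow> 'c) \<Rightarrow> 'g mv_term \<Rightarrow> 'c"
  where
    "mv_eval C v (Gen g) = v g"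
  | "mv_eval C v Zero_term = \<^bold>0\<^bsub>C\<^esub>"
  | "mv_eval C v (Neg_term t) = \<sim>\<^bsub>C\<^esub> (mv_eval C v t)"
  | "mv_eval C v (Add_term s t) = mv_eval C v s \<boxplus>\<^bsub>C\<^esub> mv_eval C v t"

lemma mv_eval_closed:
  assumes "mv_algebra C" and "\<And>g. g \<in> G \<Longrightarrow> v g \<in> carrier C" and "t \<in> carrier (mv_terms G)"
  shows "mv_eval C v t \<in> carrier C"
  using assms(3)
  by (induction t)
    (auto simp: mv_terms_simps assms(2) mv_algebra.add_closed[OF assms(1)]
      mv_algebra.neg_closed[OF assms(1)] mv_algebra.zero_closed[OF assms(1)])

lemma mv_bimorphism_closed:
  "\<lbrakk>mv_bimorphism A B C \<beta>; a \<in> carrier A; b \<in> carrier B\<rbrakk> \<Longrightarrow> \<beta> a b \<in> carrier C"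
  by (auto simp: mv_bimorphism_def mv_bilinear_def mv_linear_def Pi_iff)

lemma mv_eval_kernel_in_tensor_congs:
  fixes A :: "('a, 'm) mv_scheme" and B :: "('b, 'n) mv_scheme" and C :: "('c, 'k) mv_scheme"
  defines "F \<equiv> mv_terms (carrier A \<times> carrier B)"
  assumes A: "mv_algebra A" and B: "mv_algebra B" and C: "mv_algebra C"
    and bim: "mv_bimorphism A B C \<beta>"
  defines "e \<equiv> mv_eval C (case_prod \<beta>)"
  shows "{(s, t) \<in> carrier F \<times> carrier F. e s = e t} \<in> mv_tensor_congs A B"
proof -
  let ?\<theta> = "{(s, t) \<in> carrier F \<times> carrier F. e s = e t}"
  have cong: "mv_congruence F ?\<theta>"
    by (auto simp: mv_congruence_def equiv_def refl_on_def sym_def trans_def F_def e_def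
        mv_terms_simps)
  have e: "e t \<in> carrier C" if "t \<in> carrier F" for t
    using that unfolding e_def F_def
    by (intro mv_eval_closed[OF C]) (auto intro: mv_bimorphism_closed[OF bim])
  have alg: "mv_algebra (mv_quot F ?\<theta>)"
    using e mv_algebra.add_assoc[OF C] mv_algebra.add_comm[OF C] mv_algebra.add_zero[OF C]
      mv_algebra.neg_neg[OF C] mv_algebra.add_neg_zero[OF C] mv_algebra.lukasiewicz[OF C]
    unfolding F_def
    by (subst mv_terms_quot_algebra_iff[OF cong[unfolded F_def]])
      (simp add: mv_terms_simps e_def)
  note CA = mv_algebra.add_closed[OF A] mv_algebra.neg_closed[OF A] mv_algebra.zero_closed[OF A]
  note CB = mv_algebra.add_closed[OF B] mv_algebra.neg_closed[OF B] mv_algebra.zero_closed[OF B]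
  have "mv_bimorphism A B (mv_quot F ?\<theta>) (\<lambda>a b. ?\<theta> `` {Gen (a, b)})"
    using bim unfolding F_def
    by (subst mv_terms_quot_bimorphism_iff[OF A B cong[unfolded F_def]])
      (simp add: mv_bimorphism_def mv_bilinear_def mv_linear_def mv_le_def mv_one_def mv_join_def
        mv_meet_def mv_terms_simps e_def CA CB)
  then show ?thesis
    using cong alg by (simp add: mv_tensor_congs_def F_def)
qed

lemma mv_tensor_rel_in_congs:
  assumes A: "mv_algebra A" and B: "mv_algebra B"
  shows "mv_tensor_rel A B \<in> mv_tensor_congs A B"
proof -
  let ?F = "mv_terms (carrier A \<times> carrier B)" and ?\<Theta> = "mv_tensor_rel A B"
  define U :: "unit mv" where
    "U = \<lparr>carrier = UNIV, mv_add = (\<lambda>_ _. ()), mv_neg = (\<lambda>_. ()), mv_zero = ()\<rparr>"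
  have "mv_algebra U"
    by unfold_locales (auto simp: U_def)
  moreover have "mv_bimorphism A B U (\<lambda>_ _. ())"
    by (simp add: U_def mv_bimorphism_def mv_bilinear_def mv_linear_def mv_le_def mv_one_def)
  ultimately have "\<exists>\<theta>. \<theta> \<in> mv_tensor_congs A B"
    using mv_eval_kernel_in_tensor_congs[OF A B] by blast
  then obtain \<theta>0 where \<theta>0: "\<theta>0 \<in> mv_tensor_congs A B" ..
  have congs: "mv_congruence ?F \<theta>" if "\<theta> \<in> mv_tensor_congs A B" for \<theta>
    using that by (simp add: mv_tensor_congs_def)
  have eqs: "equiv (carrier ?F) \<theta>" if "\<theta> \<in> mv_tensor_congs A B" for \<theta>
    using congs[OF that] by (simp add: mv_congruence_def)
  have "equiv (carrier ?F) ?\<Theta>"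
  proof (rule equivI)
    show "?\<Theta> \<subseteq> carrier ?F \<times> carrier ?F"
      using \<theta>0 eqs[OF \<theta>0] by (auto simp: mv_tensor_rel_def equiv_def)
    show "refl_on (carrier ?F) ?\<Theta>"
      using eqs by (auto simp: mv_tensor_rel_def equiv_def refl_on_def)
    show "sym ?\<Theta>"
      using eqs unfolding mv_tensor_rel_def by (intro symI) (auto simp: equiv_def dest: symD)
    show "trans ?\<Theta>"
      using eqs unfolding mv_tensor_rel_def by (intro transI) (meson InterD InterI equivE transE)
  qed
  moreover have "(\<sim>\<^bsub>?F\<^esub> x, \<sim>\<^bsub>?F\<^esub> x') \<in> ?\<Theta>" if "(x, x') \<in> ?\<Theta>" for x x'
    using that congs by (simp add: mv_tensor_rel_def mv_congruence_def)
  moreover have "(x \<boxplus>\<^bsub>?F\<^esub> y, x' \<boxplus>\<^bsub>?F\<^esub> y') \<in> ?\<Theta>" if "(x, x') \<in> ?\<Theta>" "(y, y') \<in> ?\<Theta>" for x x' y y'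
    using that congs by (simp add: mv_tensor_rel_def mv_congruence_def)
  ultimately have cong: "mv_congruence ?F ?\<Theta>"
    by (simp add: mv_congruence_def)
  note alg_iff = mv_terms_quot_algebra_iff and bim_iff = mv_terms_quot_bimorphism_iff[OF A B]
  have "mv_algebra (mv_quot ?F \<theta>)" if "\<theta> \<in> mv_tensor_congs A B" for \<theta>
    using that by (simp add: mv_tensor_congs_def)
  note alg = iffD1[OF alg_iff[OF congs] this]
  have "mv_algebra (mv_quot ?F ?\<Theta>)"
    by (subst alg_iff[OF cong]) (use alg in \<open>simp add: mv_tensor_rel_def\<close>)
  moreover have "mv_bimorphism A B (mv_quot ?F \<theta>) (\<lambda>a b. \<theta> `` {Gen (a, b)})"
    if "\<theta> \<in> mv_tensor_congs A B" for \<theta>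
    using that by (simp add: mv_tensor_congs_def)
  note bim = iffD1[OF bim_iff[OF congs] this]
  have "mv_bimorphism A B (mv_quot ?F ?\<Theta>) (\<lambda>a b. ?\<Theta> `` {Gen (a, b)})"
    by (subst bim_iff[OF cong]) (use bim in \<open>simp add: mv_tensor_rel_def\<close>)
  ultimately show ?thesis
    using cong by (simp add: mv_tensor_congs_def)
qed

theorem mv_tensor_universal:
  assumes A: "mv_algebra A" and B: "mv_algebra B"
  shows "mv_algebra (mv_tensor A B)"
    and "mv_bimorphism A B (mv_tensor A B) (mv_tensor_pure A B)"
    and "\<lbrakk>mv_algebra C; mv_bimorphism A B C \<beta>\<rbrakk> \<Longrightarrow>
      \<exists>h\<in>mv_hom (mv_tensor A B) C.
        (\<forall>a\<in>carrier A. \<forall>b\<in>carrier B. h (mv_tensor_pure A B a b) = \<beta> a b) \<and>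
        (\<forall>h'\<in>mv_hom (mv_tensor A B) C.
          (\<forall>a\<in>carrier A. \<forall>b\<in>carrier B. h' (mv_tensor_pure A B a b) = \<beta> a b) \<longrightarrow>
          (\<forall>x\<in>carrier (mv_tensor A B). h' x = h x))"
proof -
  let ?F = "mv_terms (carrier A \<times> carrier B)" and ?\<Theta> = "mv_tensor_rel A B"
  have cong: "mv_congruence ?F ?\<Theta>"
    using mv_tensor_rel_in_congs[OF A B] by (simp add: mv_tensor_congs_def)
  show "mv_algebra (mv_tensor A B)"
    using mv_tensor_rel_in_congs[OF A B] by (simp add: mv_tensor_congs_def mv_tensor_def)
  show "mv_bimorphism A B (mv_tensor A B) (mv_tensor_pure A B)"
    using mv_tensor_rel_in_congs[OF A B]
    by (simp add: mv_tensor_congs_def mv_tensor_def mv_tensor_pure_def[abs_def])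
  assume C: "mv_algebra C" and bim: "mv_bimorphism A B C \<beta>"
  define e where "e = mv_eval C (case_prod \<beta>)"
  define h where "h U = e (SOME t. t \<in> U)" for U
  have e_cong: "e s = e t" if "(s, t) \<in> ?\<Theta>" for s t
    using that mv_eval_kernel_in_tensor_congs[OF A B C bim]
    unfolding mv_tensor_rel_def e_def by blast
  have h: "h (?\<Theta> `` {t}) = e t" if "t \<in> carrier ?F" for t
  proof -
    have "t \<in> ?\<Theta> `` {t}"
      using cong that by (intro equiv_class_self[of "carrier ?F"]) (simp_all add: mv_congruence_def)
    then have "(SOME s. s \<in> ?\<Theta> `` {t}) \<in> ?\<Theta> `` {t}"
      by (rule someI)
    then show ?thesis
      using e_cong unfolding h_def by force
  qed
  have e: "e t \<in> carrier C" if "t \<in> carrier ?F" for t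
    using that unfolding e_def
    by (intro mv_eval_closed[OF C]) (auto intro: mv_bimorphism_closed[OF bim])
  note Q = mv_quot_carrier mv_quot_zero mv_quot_neg[OF cong] mv_quot_add[OF cong] mv_terms_simps
  have hom: "h \<in> mv_hom (mv_tensor A B) C"
    using e by (auto simp: mv_hom_def mv_tensor_def Q h) (simp_all add: e_def)
  have pure: "h (mv_tensor_pure A B a b) = \<beta> a b" if "a \<in> carrier A" "b \<in> carrier B" for a b
    using that by (simp add: mv_tensor_pure_def h mv_terms_simps e_def)
  have uniq: "h' x = h x"
    if h': "h' \<in> mv_hom (mv_tensor A B) C"
      and gen: "\<forall>a\<in>carrier A. \<forall>b\<in>carrier B. h' (mv_tensor_pure A B a b) = \<beta> a b"
      and x: "x \<in> carrier (mv_tensor A B)" for h' x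
  proof -
    have "h' (?\<Theta> `` {t}) = e t" if "t \<in> carrier ?F" for t
      using that
    proof (induction t)
      case (Gen g)
      then show ?case
        using gen by (cases g) (simp add: mv_tensor_pure_def e_def mv_terms_simps)
    next
      case Zero_term
      have "h' \<^bold>0\<^bsub>mv_tensor A B\<^esub> = \<^bold>0\<^bsub>C\<^esub>"
        using h' by (simp add: mv_hom_def)
      then show ?case
        by (simp add: mv_tensor_def Q e_def)
    next
      case (Neg_term t)
      then have t: "t \<in> carrier ?F"
        by (simp add: mv_terms_simps)
      then have "?\<Theta> `` {t} \<in> carrier (mv_tensor A B)"
        by (simp add: mv_tensor_def Q)
      then have "h' (\<sim>\<^bsub>mv_tensor A B\<^esub> (?\<Theta> `` {t})) = \<sim>\<^bsub>C\<^esub> (h' (?\<Theta> `` {t}))"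
        using h' by (simp add: mv_hom_def)
      then show ?case
        using Neg_term.IH t by (simp add: mv_tensor_def Q e_def)
    next
      case (Add_term s t)
      then have st: "s \<in> carrier ?F" "t \<in> carrier ?F"
        by (simp_all add: mv_terms_simps)
      then have "?\<Theta> `` {s} \<in> carrier (mv_tensor A B)" "?\<Theta> `` {t} \<in> carrier (mv_tensor A B)"
        by (simp_all add: mv_tensor_def Q)
      then have "h' (?\<Theta> `` {s} \<boxplus>\<^bsub>mv_tensor A B\<^esub> ?\<Theta> `` {t}) = h' (?\<Theta> `` {s}) \<boxplus>\<^bsub>C\<^esub> h' (?\<Theta> `` {t})"
        using h' by (simp add: mv_hom_def)
      then show ?case
        using Add_term.IH st by (simp add: mv_tensor_def Q e_def)
    qed
    then show ?thesis
      using x h by (auto simp: mv_tensor_def mv_quot_carrier)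
  qed
  show "\<exists>h\<in>mv_hom (mv_tensor A B) C.
      (\<forall>a\<in>carrier A. \<forall>b\<in>carrier B. h (mv_tensor_pure A B a b) = \<beta> a b) \<and>
      (\<forall>h'\<in>mv_hom (mv_tensor A B) C.
        (\<forall>a\<in>carrier A. \<forall>b\<in>carrier B. h' (mv_tensor_pure A B a b) = \<beta> a b) \<longrightarrow>
        (\<forall>x\<in>carrier (mv_tensor A B). h' x = h x))"
    using hom pure uniq by blast
qed

end

(* Let T be the MV-tensor product of R and P. A homomorphism h from T to [0,1] satisfies
   h (a (x) b) = h (a (x) 1) * h (1 (x) b), and both factors are homomorphisms, because a linear
   functional f that vanishes on the kernel of a homomorphism g is the multiple f 1 * g. For the
   same reason homomorphisms of a PMV-algebra into [0,1] are multiplicative, and those of a Riesz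
   MV-algebra commute with scalars. The scalars of R embed [0,1] linearly into T, so every maximal
   ideal of T is the kernel of a homomorphism into [0,1] (by a Dedekind cut argument), and T / Rad T
   is separated by such homomorphisms. It remains to find, for s and t in T, elements of T on which
   every h takes the values h s * h t and c * h t. *)
theory Submission
  imports Defs
begin

section \<open>MV-algebra calculus\<close>

text \<open>The product is prescribed on pure tensors only, while a general element is a term built
  from them by negation and truncated sums; a recursive definition on terms would have to respect
  every relation of the tensor product. The way out is to let real values decide. In an algebra
  separated by homomorphisms into \<open>[0,1]\<close> an element is determined by its values, and
  the laws of a product and of a scalar multiplication become laws of real numbers. Only the
  existence of an element with prescribed values is then at stake. The price is twofold:
  homomorphisms must be shown to respect products and scalars although they are only assumed to
  preserve the MV-operations, and the radical, defined by maximal ideals, must be rewritten in terms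
  of values. Scalars enter through \<open>R\<close>: the tensor of the scalar multiple
  \<open>\<alpha> 1\<close> in \<open>R\<close> with \<open>1\<close> in \<open>P\<close> has value
  \<open>\<alpha>\<close> under every homomorphism, so the scalar action is multiplication by
  it.\<close>

context mv_algebra
begin

lemma one_closed: "\<^bold>1 \<in> carrier M"
  by (simp add: mv_one_def zero_closed neg_closed)

lemma diff_closed: "\<lbrakk>x \<in> carrier M; y \<in> carrier M\<rbrakk> \<Longrightarrow> mv_diff M x y \<in> carrier M"
  by (simp add: mv_diff_def add_closed neg_closed)

lemmas closed = add_closed neg_closed zero_closed one_closed diff_closed

lemma neg_one: "\<sim> \<^bold>1 = \<^bold>0"
  by (simp add: mv_one_def neg_neg zero_closed)

lemma add_one: "x \<in> carrier M \<Longrightarrow> x \<boxplus> \<^bold>1 = \<^bold>1"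
  by (simp add: mv_one_def add_neg_zero)

lemma one_add: "x \<in> carrier M \<Longrightarrow> \<^bold>1 \<boxplus> x = \<^bold>1"
  by (metis add_one add_comm one_closed)

lemma zero_add: "x \<in> carrier M \<Longrightarrow> \<^bold>0 \<boxplus> x = x"
  by (metis add_zero add_comm zero_closed)

lemma add_left_commute:
  "\<lbrakk>x \<in> carrier M; y \<in> carrier M; z \<in> carrier M\<rbrakk> \<Longrightarrow> x \<boxplus> (y \<boxplus> z) = y \<boxplus> (x \<boxplus> z)"
  by (metis add_assoc add_comm)

lemmas add_ac = add_assoc add_comm add_left_commute

text \<open>The Lukasiewicz axiom at \<open>x\<close> and \<open>1\<close>: its left side collapses
  to \<open>1\<close>, its right side to the sum.\<close>

lemma neg_add_self: "x \<in> carrier M \<Longrightarrow> \<sim> x \<boxplus> x = \<^bold>1"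
  using lukasiewicz[of x "\<^bold>1"] by (simp add: add_one neg_one zero_add closed)

section \<open>The natural order and truncated subtraction\<close>

lemma le_refl: "x \<in> carrier M \<Longrightarrow> x \<preceq> x"
  by (simp add: mv_le_def neg_add_self)

lemma le_add: "\<lbrakk>x \<in> carrier M; z \<in> carrier M\<rbrakk> \<Longrightarrow> x \<preceq> x \<boxplus> z"
  by (simp add: mv_le_def add_assoc[symmetric] closed neg_add_self one_add)

text \<open>Both sides of the Lukasiewicz axiom are the join, and for comparable elements one of
  them reduces to \<open>y\<close>. Writing the larger element as the smaller one plus a remainder
  is what yields transitivity and monotonicity below.\<close>

lemma add_diff_cancel:
  assumes "x \<in> carrier M" "y \<in> carrier M" "x \<preceq> y"
  shows "x \<boxplus> mv_diff M y x = y"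
  using lukasiewicz[of x y] assms
  by (simp add: mv_le_def mv_diff_def neg_one zero_add add_zero closed add_comm)

lemma le_trans:
  assumes "x \<in> carrier M" "y \<in> carrier M" "z \<in> carrier M" "x \<preceq> y" "y \<preceq> z"
  shows "x \<preceq> z"
proof -
  have "z = (x \<boxplus> mv_diff M y x) \<boxplus> mv_diff M z y"
    using assms by (simp add: add_diff_cancel)
  also have "\<dots> = x \<boxplus> (mv_diff M y x \<boxplus> mv_diff M z y)"
    using assms by (simp add: add_assoc closed)
  finally show ?thesis
    using le_add[of x "mv_diff M y x \<boxplus> mv_diff M z y"] assms by (simp add: closed)
qed

lemma add_mono:
  assumes "x \<in> carrier M" "y \<in> carrier M" "x' \<in> carrier M" "y' \<in> carrier M" "x \<preceq> x'" "y \<preceq> y'"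
  shows "x \<boxplus> y \<preceq> x' \<boxplus> y'"
proof -
  let ?d = "mv_diff M x' x" and ?e = "mv_diff M y' y"
  have "x' \<boxplus> y' = (x \<boxplus> ?d) \<boxplus> (y \<boxplus> ?e)"
    using add_diff_cancel assms by simp
  also have "\<dots> = (x \<boxplus> y) \<boxplus> (?d \<boxplus> ?e)"
    using assms by (simp add: add_ac closed)
  finally show ?thesis
    using le_add[of "x \<boxplus> y" "?d \<boxplus> ?e"] assms by (simp add: closed)
qed

lemma le_one: "x \<in> carrier M \<Longrightarrow> x \<preceq> \<^bold>1"
  by (simp add: mv_le_def add_one closed)

lemma le_neg_iff: "\<lbrakk>x \<in> carrier M; y \<in> carrier M\<rbrakk> \<Longrightarrow> x \<preceq> \<sim> y \<longleftrightarrow> y \<preceq> \<sim> x"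
  by (simp add: mv_le_def add_comm closed)

text \<open>Residuation: subtracting \<open>y\<close> is left adjoint to adding \<open>y\<close>.
  Estimates for differences are moved to sums this way, where \<open>add_mono\<close>
  applies.\<close>

lemma diff_le_iff:
  "\<lbrakk>x \<in> carrier M; y \<in> carrier M; z \<in> carrier M\<rbrakk> \<Longrightarrow> mv_diff M x y \<preceq> z \<longleftrightarrow> x \<preceq> y \<boxplus> z"
  by (simp add: mv_le_def mv_diff_def neg_neg closed add_assoc)

lemma le_neg_diff: "\<lbrakk>x \<in> carrier M; y \<in> carrier M\<rbrakk> \<Longrightarrow> x \<preceq> \<sim> (mv_diff M y x)"
  by (simp add: mv_le_def mv_diff_def neg_neg closed add_left_commute[of "\<sim> x"] neg_add_self add_one)

lemma diff_le: "\<lbrakk>x \<in> carrier M; y \<in> carrier M\<rbrakk> \<Longrightarrow> mv_diff M x y \<preceq> x"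
  by (metis diff_le_iff add_comm le_add)

lemma le_add_diff: "\<lbrakk>x \<in> carrier M; y \<in> carrier M\<rbrakk> \<Longrightarrow> x \<preceq> y \<boxplus> mv_diff M x y"
  by (metis diff_le_iff diff_closed le_refl)

lemma diff_triangle:
  assumes "x \<in> carrier M" "y \<in> carrier M" "z \<in> carrier M"
  shows "mv_diff M x z \<preceq> mv_diff M x y \<boxplus> mv_diff M y z"
proof -
  have "y \<boxplus> mv_diff M x y \<preceq> (z \<boxplus> mv_diff M y z) \<boxplus> mv_diff M x y"
    using assms by (intro add_mono) (simp_all add: le_add_diff le_refl closed)
  then have "x \<preceq> (z \<boxplus> mv_diff M y z) \<boxplus> mv_diff M x y"
    using assms by (intro le_trans[OF _ _ _ le_add_diff[of x y]]) (simp_all add: closed)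
  then show ?thesis
    using assms by (simp add: diff_le_iff closed add_ac)
qed

lemma diff_add_le:
  assumes "x \<in> carrier M" "y \<in> carrier M" "x' \<in> carrier M" "y' \<in> carrier M"
  shows "mv_diff M (x \<boxplus> y) (x' \<boxplus> y') \<preceq> mv_diff M x x' \<boxplus> mv_diff M y y'"
proof -
  have "x \<boxplus> y \<preceq> (x' \<boxplus> mv_diff M x x') \<boxplus> (y' \<boxplus> mv_diff M y y')"
    using assms by (simp add: add_mono le_add_diff closed)
  then show ?thesis
    using assms by (simp add: diff_le_iff closed add_ac)
qed

lemma diff_neg_neg: "\<lbrakk>x \<in> carrier M; y \<in> carrier M\<rbrakk> \<Longrightarrow> mv_diff M (\<sim> x) (\<sim> y) = mv_diff M y x"
  by (simp add: mv_diff_def neg_neg closed add_comm)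

lemma diff_zero: "x \<in> carrier M \<Longrightarrow> mv_diff M x \<^bold>0 = x"
  by (simp add: mv_diff_def add_zero neg_neg closed)

lemma diff_one: "x \<in> carrier M \<Longrightarrow> mv_diff M x \<^bold>1 = \<^bold>0"
  by (simp add: mv_diff_def add_one neg_one closed)

lemma diff_add: "\<lbrakk>x \<in> carrier M; y \<in> carrier M; z \<in> carrier M\<rbrakk>
    \<Longrightarrow> mv_diff M x (y \<boxplus> z) = mv_diff M (mv_diff M x y) z"
  by (simp add: mv_diff_def neg_neg closed add_assoc)

lemma diff_antimono:
  assumes "x \<in> carrier M" "y \<in> carrier M" "z \<in> carrier M" "y \<preceq> z"
  shows "mv_diff M x z \<preceq> mv_diff M x y"
  using le_trans[OF _ _ _ le_add_diff[of x y] add_mono[of y "mv_diff M x y" z "mv_diff M x y"]] assms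
  by (simp add: diff_le_iff closed le_refl)

text \<open>In \<open>[0,1]\<close> either \<open>a + x \<ge> 1\<close> or the truncated excess \<open>a + x - 1\<close> is \<open>0\<close>.\<close>

lemma add_add_excess:
  assumes a: "a \<in> carrier M" and x: "x \<in> carrier M"
  shows "(x \<boxplus> a) \<boxplus> mv_diff M a (\<sim> x) = x \<boxplus> a"
proof -
  let ?p = "mv_diff M a (\<sim> x)" and ?w = "mv_diff M (x \<boxplus> a) a"
  have p: "?p = mv_diff M x (\<sim> a)"
    using a x by (simp add: mv_diff_def add_comm closed)
  have "?w = mv_diff M x ?p"
    using lukasiewicz[of "\<sim> x" a] a x by (simp add: mv_diff_def neg_neg closed add_comm)
  then have "?p \<boxplus> ?w = x"
    using a x p add_diff_cancel[of ?p x] diff_le[of x "\<sim> a"] by (simp add: closed)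
  moreover have "a \<boxplus> ?w = x \<boxplus> a"
    using a x add_diff_cancel[of a "x \<boxplus> a"] le_add[of a x] by (simp add: closed add_comm)
  moreover have "(a \<boxplus> ?w) \<boxplus> ?p = a \<boxplus> (?p \<boxplus> ?w)"
    using a x by (simp add: add_ac closed)
  ultimately show ?thesis
    using a x by (simp add: add_comm)
qed

text \<open>Opposite truncated differences are disjoint: in \<open>[0,1]\<close> one of them is
  \<open>0\<close>. This is the excess law with \<open>\<sim> b\<close> for its second
  element.\<close>

lemma neg_diff_add_diff:
  assumes "a \<in> carrier M" "b \<in> carrier M"
  shows "\<sim> (mv_diff M b a) \<boxplus> mv_diff M a b = \<sim> (mv_diff M b a)"
  using add_add_excess[of a "\<sim> b"] assms by (simp add: mv_diff_def neg_neg closed)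

text \<open>Disjointness is inherited downwards: \<open>\<sim> t\<close> is \<open>\<sim> ?v\<close>
  plus a remainder, so it absorbs \<open>?u\<close> because \<open>\<sim> ?v\<close> does.\<close>

lemma diff_diff_of_le_diff:
  assumes "a \<in> carrier M" "b \<in> carrier M" "t \<in> carrier M" "t \<preceq> mv_diff M b a"
  shows "mv_diff M t (mv_diff M a b) = t"
proof -
  let ?v = "mv_diff M b a" and ?u = "mv_diff M a b"
  have "\<sim> ?v \<preceq> \<sim> t"
    using assms le_neg_iff[of "\<sim> ?v" t] by (simp add: neg_neg closed)
  define r where "r = mv_diff M (\<sim> t) (\<sim> ?v)"
  have r: "r \<in> carrier M" "\<sim> t = \<sim> ?v \<boxplus> r"
    using \<open>\<sim> ?v \<preceq> \<sim> t\<close> add_diff_cancel[of "\<sim> ?v" "\<sim> t"] assms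
    by (simp_all add: r_def closed)
  have "\<sim> t \<boxplus> ?u = (\<sim> ?v \<boxplus> ?u) \<boxplus> r"
    unfolding r(2) using r(1) assms by (simp add: add_ac closed)
  also have "\<dots> = \<sim> t"
    using neg_diff_add_diff[of a b] r assms by simp
  finally have "\<sim> t \<boxplus> ?u = \<sim> t" .
  then show ?thesis
    using assms by (simp add: mv_diff_def neg_neg closed)
qed

subsection \<open>Maximal ideals\<close>

text \<open>\<open>J\<close> is a polar of \<open>?v\<close> modulo \<open>I\<close>: subtracting a
  member of \<open>J\<close> cannot bring an element below \<open>?v\<close> into \<open>I\<close>
  from outside. It is an ideal above \<open>I\<close>, and disjointness puts
  \<open>mv_diff M a b\<close> into it, so maximality makes it the whole algebra. Membership of
  \<open>1\<close>, tested at \<open>t = ?v\<close>, is the claim.\<close>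

lemma maximal_ideal_prime:
  assumes I: "mv_maximal_ideal M I" and a: "a \<in> carrier M" and b: "b \<in> carrier M"
    and u: "mv_diff M a b \<notin> I"
  shows "mv_diff M b a \<in> I"
proof -
  let ?v = "mv_diff M b a"
  define J where "J = {y \<in> carrier M. \<forall>t\<in>carrier M. t \<preceq> ?v \<longrightarrow> mv_diff M t y \<in> I \<longrightarrow> t \<in> I}"
  have I': "I \<subseteq> carrier M" "\<^bold>0 \<in> I" and Iadd: "\<And>x y. \<lbrakk>x \<in> I; y \<in> I\<rbrakk> \<Longrightarrow> x \<boxplus> y \<in> I"
    and Ile: "\<And>x y. \<lbrakk>x \<in> I; y \<in> carrier M; y \<preceq> x\<rbrakk> \<Longrightarrow> y \<in> I"
    using I by (auto simp: mv_maximal_ideal_def mv_ideal_def)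
  have "y \<boxplus> z \<in> J" if "y \<in> J" "z \<in> J" for y z
  proof -
    have yz: "y \<in> carrier M" "z \<in> carrier M"
      using that by (auto simp: J_def)
    have "t \<in> I" if t: "t \<in> carrier M" "t \<preceq> ?v" "mv_diff M t (y \<boxplus> z) \<in> I" for t
    proof -
      have "mv_diff M t y \<preceq> ?v"
        using t yz a b le_trans[OF _ _ _ diff_le[of t y]] by (simp add: closed)
      then have "mv_diff M t y \<in> I"
        using \<open>z \<in> J\<close> t yz by (simp add: J_def diff_add closed)
      then show ?thesis
        using \<open>y \<in> J\<close> t by (simp add: J_def)
    qed
    then show ?thesis
      using yz by (simp add: J_def closed)
  qed
  moreover have "y \<in> J" if "x \<in> J" "y \<in> carrier M" "y \<preceq> x" for x y
  proof -
    have x: "x \<in> carrier M"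
      using that by (simp add: J_def)
    have "mv_diff M t x \<in> I" if "t \<in> carrier M" "mv_diff M t y \<in> I" for t
      using that x \<open>y \<in> carrier M\<close> \<open>y \<preceq> x\<close>
      by (intro Ile[OF that(2)] diff_antimono) (simp_all add: closed)
    then show ?thesis
      using that by (auto simp: J_def)
  qed
  moreover have "J \<subseteq> carrier M" "\<^bold>0 \<in> J"
    by (auto simp: J_def diff_zero closed)
  ultimately have "mv_ideal M J"
    unfolding mv_ideal_def by blast
  moreover have "I \<subseteq> J"
  proof
    fix y assume y: "y \<in> I"
    then have "y \<in> carrier M" using I' by auto
    moreover have "t \<in> I" if "t \<in> carrier M" "mv_diff M t y \<in> I" for t
      using y that \<open>y \<in> carrier M\<close> by (intro Ile[OF Iadd[OF y that(2)]] le_add_diff)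
    ultimately show "y \<in> J"
      by (simp add: J_def)
  qed
  moreover have "mv_diff M a b \<in> J"
    using a b by (simp add: J_def closed diff_diff_of_le_diff)
  ultimately have "J = carrier M"
    using I u unfolding mv_maximal_ideal_def by blast
  then have "\<^bold>1 \<in> J"
    by (simp add: closed)
  then show ?thesis
    using I' a b by (simp add: J_def diff_one closed le_refl)
qed

end
section \<open>Homomorphisms to the unit interval\<close>

lemma unit_interval_mv_simps:
  "carrier unit_interval_mv = {0..1}"
  "x \<boxplus>\<^bsub>unit_interval_mv\<^esub> y = min 1 (x + y)"
  "\<sim>\<^bsub>unit_interval_mv\<^esub> x = 1 - x"
  "\<^bold>0\<^bsub>unit_interval_mv\<^esub> = 0"
  "\<^bold>1\<^bsub>unit_interval_mv\<^esub> = 1"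
  by (simp_all add: unit_interval_mv_def mv_one_def)

lemma unit_interval_mv_le:
  "x \<preceq>\<^bsub>unit_interval_mv\<^esub> y \<longleftrightarrow> x \<le> y"
  by (auto simp: mv_le_def unit_interval_mv_simps)

lemma mv_algebra_unit_interval: "mv_algebra unit_interval_mv"
  by unfold_locales (auto simp: unit_interval_mv_simps min_def)

lemma unit_hom:
  assumes "h \<in> mv_hom M unit_interval_mv"
  shows unit_hom_ge0: "x \<in> carrier M \<Longrightarrow> 0 \<le> h x"
    and unit_hom_le1: "x \<in> carrier M \<Longrightarrow> h x \<le> 1"
    and unit_hom_add: "\<lbrakk>x \<in> carrier M; y \<in> carrier M\<rbrakk> \<Longrightarrow> h (x \<boxplus>\<^bsub>M\<^esub> y) = min 1 (h x + h y)"
    and unit_hom_neg: "x \<in> carrier M \<Longrightarrow> h (\<sim>\<^bsub>M\<^esub> x) = 1 - h x"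
    and unit_hom_zero: "h \<^bold>0\<^bsub>M\<^esub> = 0"
  using assms by (auto simp: mv_hom_def unit_interval_mv_simps Pi_iff)

lemma unit_linear:
  assumes "mv_linear M unit_interval_mv f"
  shows unit_linear_ge0: "x \<in> carrier M \<Longrightarrow> 0 \<le> f x"
    and unit_linear_le1: "x \<in> carrier M \<Longrightarrow> f x \<le> 1"
    and unit_linear_add: "\<lbrakk>x \<in> carrier M; y \<in> carrier M; x \<preceq>\<^bsub>M\<^esub> \<sim>\<^bsub>M\<^esub> y\<rbrakk>
      \<Longrightarrow> f (x \<boxplus>\<^bsub>M\<^esub> y) = f x + f y"
proof -
  have f: "f x \<in> {0..1}" if "x \<in> carrier M" for x
    using assms that by (auto simp: mv_linear_def unit_interval_mv_simps)
  show "x \<in> carrier M \<Longrightarrow> 0 \<le> f x" "x \<in> carrier M \<Longrightarrow> f x \<le> 1"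
    using f by auto
  assume xy: "x \<in> carrier M" "y \<in> carrier M" "x \<preceq>\<^bsub>M\<^esub> \<sim>\<^bsub>M\<^esub> y"
  then have "f x \<le> 1 - f y" "f (x \<boxplus>\<^bsub>M\<^esub> y) = min 1 (f x + f y)"
    using assms by (simp_all add: mv_linear_def unit_interval_mv_simps unit_interval_mv_le)
  then show "f (x \<boxplus>\<^bsub>M\<^esub> y) = f x + f y"
    by simp
qed

lemma mv_linear_compose:
  "\<lbrakk>mv_linear A B f; mv_linear B C g; \<And>x. x \<in> carrier A \<Longrightarrow> f x \<in> carrier B\<rbrakk>
    \<Longrightarrow> mv_linear A C (\<lambda>x. g (f x))"
  by (auto simp: mv_linear_def Pi_iff)

context mv_algebra
begin

lemma unit_hom_one: "h \<in> mv_hom M unit_interval_mv \<Longrightarrow> h \<^bold>1 = 1"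
  by (simp add: mv_one_def unit_hom closed)

lemma unit_hom_diff:
  "\<lbrakk>h \<in> mv_hom M unit_interval_mv; x \<in> carrier M; y \<in> carrier M\<rbrakk>
    \<Longrightarrow> h (mv_diff M x y) = max 0 (h x - h y)"
  by (simp add: mv_diff_def unit_hom closed)

lemma unit_hom_mono:
  assumes "h \<in> mv_hom M unit_interval_mv" "x \<in> carrier M" "y \<in> carrier M" "x \<preceq> y"
  shows "h x \<le> h y"
proof -
  have "min 1 (1 - h x + h y) = 1"
    using assms(4) unit_hom_one[OF assms(1)] unit_hom[OF assms(1)] assms(2,3)
    by (metis mv_le_def neg_closed)
  then show ?thesis
    by simp
qed

lemma unit_hom_linear:
  assumes "h \<in> mv_hom M unit_interval_mv"
  shows "mv_linear M unit_interval_mv h"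
  unfolding mv_linear_def unit_interval_mv_simps unit_interval_mv_le
proof (intro conjI ballI impI)
  show "h \<in> carrier M \<rightarrow> {0..1}"
    by (auto simp: unit_hom[OF assms])
next
  fix x y assume "x \<in> carrier M" "y \<in> carrier M" "x \<preceq> \<sim> y"
  then show "h x \<le> 1 - h y" "h (x \<boxplus> y) = min 1 (h x + h y)"
    using unit_hom_mono[OF assms, of x "\<sim> y"] by (simp_all add: unit_hom[OF assms] closed)
qed

lemma unit_linear_diff:
  assumes "mv_linear M unit_interval_mv f" "x \<in> carrier M" "y \<in> carrier M" "x \<preceq> y"
  shows "f y = f x + f (mv_diff M y x)"
  using unit_linear_add[OF assms(1), of x "mv_diff M y x"] assms
  by (simp add: add_diff_cancel le_neg_diff closed)

lemma unit_linear_mono: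
  assumes "mv_linear M unit_interval_mv f" "x \<in> carrier M" "y \<in> carrier M" "x \<preceq> y"
  shows "f x \<le> f y"
  using unit_linear_diff[OF assms] unit_linear_ge0[OF assms(1), of "mv_diff M y x"] assms
  by (simp add: closed)

text \<open>Passing from \<open>x\<close> to \<open>x \<boxplus> x\<close> or to \<open>x \<odot> x\<close> (whichever \<open>h\<close> does not truncate) doubles the
  defect \<open>f x - f \<^bold>1 * h x\<close>, which is bounded.\<close>

lemma unit_linear_eq_scaled_hom:
  assumes f: "mv_linear M unit_interval_mv f" and h: "h \<in> mv_hom M unit_interval_mv"
    and ker: "\<And>x. \<lbrakk>x \<in> carrier M; h x = 0\<rbrakk> \<Longrightarrow> f x = 0"
    and x: "x \<in> carrier M"
  shows "f x = f \<^bold>1 * h x"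
proof -
  define d where "d y = f y - f \<^bold>1 * h y" for y
  have double: "\<exists>z\<in>carrier M. d z = 2 * d y" if y: "y \<in> carrier M" for y
  proof -
    \<comment> \<open>In \<open>[0,1]\<close> these are \<open>min 1 (2y)\<close>,
      \<open>min y (1 - y)\<close> and \<open>max 0 (2y - 1)\<close>, the last being
      \<open>y \<odot> y\<close>. Both \<open>s = y + w\<close> and \<open>y = w + v\<close> are
      partial sums, so additivity gives \<open>f s + f v = 2 * f y\<close>.\<close>
    define s w v where "s = y \<boxplus> y" and "w = mv_diff M s y" and "v = mv_diff M y w"
    have C: "s \<in> carrier M" "w \<in> carrier M" "v \<in> carrier M"
      using y by (simp_all add: s_def w_def v_def closed)
    have "y \<preceq> s" "w \<preceq> y"
      using y by (simp_all add: s_def w_def le_add diff_le_iff le_refl closed)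
    then have f1: "f s = f y + f w" "f y = f w + f v"
      using unit_linear_diff[OF f] C y by (simp_all add: w_def v_def)
    have h1: "h s = min 1 (2 * h y)" "h w = max 0 (h s - h y)" "h v = max 0 (h y - h w)"
      using C y by (simp_all add: s_def w_def v_def unit_hom[OF h] unit_hom_diff[OF h])
    show ?thesis
    proof (cases "h y \<le> 1/2")
      case True
      then have "h v = 0" "h s = 2 * h y"
        using h1 unit_hom_ge0[OF h y] by auto
      then have "d s = 2 * d y"
        using f1 ker[OF C(3)] by (simp add: d_def algebra_simps)
      then show ?thesis
        using C by blast
    next
      case False
      then have hs: "h s = 1" "h v = 2 * h y - 1"
        using h1 unit_hom_le1[OF h y] by auto
      \<comment> \<open>The complement of \<open>s\<close> lies in the kernel of \<open>h\<close>,
        so \<open>f s\<close> is \<open>f 1\<close>.\<close>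
      have "f \<^bold>1 = f s + f (mv_diff M \<^bold>1 s)"
        using C by (intro unit_linear_diff[OF f]) (simp_all add: closed le_one)
      moreover have "f (mv_diff M \<^bold>1 s) = 0"
        using C hs by (intro ker) (simp_all add: closed unit_hom_diff[OF h] unit_hom_one[OF h])
      ultimately have "f v = 2 * f y - f \<^bold>1"
        using f1 by simp
      then have "d v = 2 * d y"
        by (simp add: d_def hs(2) algebra_simps)
      then show ?thesis
        using C by blast
    qed
  qed
  have iter: "\<exists>z\<in>carrier M. d z = 2 ^ n * d x" for n
  proof (induction n)
    case (Suc n)
    then obtain z where z: "z \<in> carrier M" "d z = 2 ^ n * d x"
      by blast
    then show ?case
      using double[OF z(1)] by (simp add: mult.assoc)
  qed (use x in auto)
  have bound: "\<bar>d z\<bar> \<le> 1" if z: "z \<in> carrier M" for z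
  proof -
    note f01 = unit_linear_ge0[OF f] unit_linear_le1[OF f]
    have "0 \<le> f \<^bold>1 * h z" "f \<^bold>1 * h z \<le> 1"
      using z f01[of "\<^bold>1"] unit_hom_ge0[OF h z] unit_hom_le1[OF h z]
      by (simp_all add: closed mult_le_one)
    then show ?thesis
      using f01[OF z] by (simp add: d_def abs_le_iff)
  qed
  have "d x = 0"
  proof (rule ccontr)
    assume "d x \<noteq> 0"
    then obtain n where "1 / \<bar>d x\<bar> < 2 ^ n"
      using real_arch_pow[of 2 "1 / \<bar>d x\<bar>"] by auto
    then have n: "1 < 2 ^ n * \<bar>d x\<bar>"
      using \<open>d x \<noteq> 0\<close> by (simp add: field_simps)
    obtain z where "z \<in> carrier M" "d z = 2 ^ n * d x"
      using iter by blast
    with bound[of z] n show False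
      by (simp add: abs_mult)
  qed
  then show ?thesis
    by (simp add: d_def)
qed

subsection \<open>The radical as a common kernel\<close>

lemma unit_hom_kernel_ideal:
  assumes h: "h \<in> mv_hom M unit_interval_mv"
  shows "mv_ideal M {x \<in> carrier M. h x = 0}"
proof -
  have "h y = 0" if "x \<in> carrier M" "h x = 0" "y \<in> carrier M" "y \<preceq> x" for x y
    using unit_hom_mono[OF h, of y x] unit_hom_ge0[OF h, of y] that by simp
  then show ?thesis
    by (auto simp: mv_ideal_def closed unit_hom[OF h])
qed

text \<open>The reals are Archimedean: if a larger ideal has a member with positive value, some
  multiple of it has value \<open>1\<close>. The negation of that multiple lies in the kernel, and
  the two add up to \<open>1\<close>.\<close>

lemma unit_hom_kernel_maximal:
  assumes h: "h \<in> mv_hom M unit_interval_mv"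
  shows "mv_maximal_ideal M {x \<in> carrier M. h x = 0}" (is "mv_maximal_ideal M ?K")
  unfolding mv_maximal_ideal_def
proof (intro conjI allI impI)
  show "mv_ideal M ?K"
    by (rule unit_hom_kernel_ideal[OF h])
  have "\<^bold>1 \<notin> ?K"
    by (simp add: unit_hom_one[OF h])
  then show "?K \<noteq> carrier M"
    using one_closed by metis
  fix J assume J: "mv_ideal M J" "?K \<subseteq> J"
  then have JD: "J \<subseteq> carrier M" "\<^bold>0 \<in> J" and Jadd: "\<And>x y. \<lbrakk>x \<in> J; y \<in> J\<rbrakk> \<Longrightarrow> x \<boxplus> y \<in> J"
    and Jle: "\<And>x y. \<lbrakk>x \<in> J; y \<in> carrier M; y \<preceq> x\<rbrakk> \<Longrightarrow> y \<in> J"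
    by (auto simp: mv_ideal_def)
  show "J = ?K \<or> J = carrier M"
  proof (cases "J = ?K")
    case False
    then obtain x where x: "x \<in> J" "x \<in> carrier M" "h x \<noteq> 0"
      using J JD by blast
    then have pos: "0 < h x"
      using unit_hom_ge0[OF h, of x] by simp
    have mult: "\<exists>y\<in>J. h y = min 1 (real n * h x)" for n
    proof (induction n)
      case 0
      then show ?case
        using JD unit_hom_zero[OF h] by auto
    next
      case (Suc n)
      then obtain y where y: "y \<in> J" "h y = min 1 (real n * h x)"
        by blast
      have "h (y \<boxplus> x) = min 1 (h y + h x)"
        using x y JD by (intro unit_hom_add[OF h]) auto
      also have "\<dots> = min 1 (real (Suc n) * h x)"
        using y pos by (auto simp: algebra_simps min_def)
      finally show ?case
        using Jadd[OF y(1) x(1)] by blast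
    qed
    obtain n where "1 < real n * h x"
      using ex_less_of_nat_mult[OF pos] by blast
    then obtain y where y: "y \<in> J" "y \<in> carrier M" "h y = 1"
      using mult[of n] JD by fastforce
    then have "\<sim> y \<in> J"
      using J(2) by (auto simp: closed unit_hom_neg[OF h])
    then have "\<^bold>1 \<in> J"
      using Jadd[of "\<sim> y" y] y by (simp add: neg_add_self)
    then show ?thesis
      using JD Jle le_one by blast
  qed simp
qed

section \<open>Maximal ideals as kernels, by Dedekind cuts\<close>

lemma add_diff_cancel_left:
  assumes "a \<in> carrier M" "c \<in> carrier M" "a \<preceq> \<sim> c"
  shows "mv_diff M (a \<boxplus> c) a = c"
  using lukasiewicz[of "\<sim> c" a] assms
  by (simp add: mv_le_def mv_diff_def neg_neg closed neg_one zero_add add_comm[of c a])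

lemma diff_mono:
  assumes "x \<in> carrier M" "y \<in> carrier M" "z \<in> carrier M" "x \<preceq> y"
  shows "mv_diff M x z \<preceq> mv_diff M y z"
  using le_trans[OF _ _ _ assms(4) le_add_diff[of y z]] assms by (simp add: diff_le_iff closed)

text \<open>The scalars \<open>\<sigma> \<alpha>\<close> play the role of the rational multiples in Hoelder's theorem: an element
  is sent to the Dedekind cut formed by the scalars below and above it modulo the ideal.\<close>

lemma maximal_ideal_eq_unit_hom_kernel:
  assumes lin: "mv_linear unit_interval_mv M \<sigma>" and \<sigma>1: "\<sigma> 1 = \<^bold>1"
    and max: "mv_maximal_ideal M I"
  obtains h where "h \<in> mv_hom M unit_interval_mv" "I = {x \<in> carrier M. h x = 0}"
proof -
  have I: "I \<subseteq> carrier M" "\<^bold>0 \<in> I" and Iadd: "\<And>x y. \<lbrakk>x \<in> I; y \<in> I\<rbrakk> \<Longrightarrow> x \<boxplus> y \<in> I"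
    and Ile: "\<And>x y. \<lbrakk>x \<in> I; y \<in> carrier M; y \<preceq> x\<rbrakk> \<Longrightarrow> y \<in> I"
    and proper: "I \<noteq> carrier M"
    using max by (auto simp: mv_maximal_ideal_def mv_ideal_def)
  have \<sigma>C: "\<sigma> \<alpha> \<in> carrier M" if "\<alpha> \<in> {0..1}" for \<alpha>
    using lin that by (auto simp: mv_linear_def unit_interval_mv_simps)
  have \<sigma>_add: "\<sigma> \<alpha> \<preceq> \<sim> (\<sigma> \<beta>)" "\<sigma> (\<alpha> + \<beta>) = \<sigma> \<alpha> \<boxplus> \<sigma> \<beta>"
    if "0 \<le> \<alpha>" "0 \<le> \<beta>" "\<alpha> + \<beta> \<le> 1" for \<alpha> \<beta>
  proof -
    have "\<alpha> \<in> {0..1}" "\<beta> \<in> {0..1}" "min 1 (\<alpha> + \<beta>) = \<alpha> + \<beta>" "\<alpha> \<le> 1 - \<beta>"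
      using that by auto
    then show "\<sigma> \<alpha> \<preceq> \<sim> (\<sigma> \<beta>)" "\<sigma> (\<alpha> + \<beta>) = \<sigma> \<alpha> \<boxplus> \<sigma> \<beta>"
      using lin unfolding mv_linear_def unit_interval_mv_simps unit_interval_mv_le by metis+
  qed
  have \<sigma>_diff: "mv_diff M (\<sigma> \<beta>) (\<sigma> \<alpha>) = \<sigma> (\<beta> - \<alpha>)" if "0 \<le> \<alpha>" "\<alpha> \<le> \<beta>" "\<beta> \<le> 1" for \<alpha> \<beta>
    using \<sigma>_add[of \<alpha> "\<beta> - \<alpha>"] add_diff_cancel_left[of "\<sigma> \<alpha>" "\<sigma> (\<beta> - \<alpha>)"] that
    by (simp add: \<sigma>C)
  have \<sigma>_neg: "\<sim> (\<sigma> \<alpha>) = \<sigma> (1 - \<alpha>)" if "\<alpha> \<in> {0..1}" for \<alpha>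
    using \<sigma>_diff[of \<alpha> 1] that by (simp add: \<sigma>1 mv_diff_def neg_one zero_add closed \<sigma>C)
  have \<sigma>0: "\<sigma> 0 = \<^bold>0"
    using \<sigma>_neg[of 1] by (simp add: \<sigma>1 neg_one)
  have \<sigma>_mono: "\<sigma> \<alpha> \<preceq> \<sigma> \<beta>" if "0 \<le> \<alpha>" "\<alpha> \<le> \<beta>" "\<beta> \<le> 1" for \<alpha> \<beta>
    using \<sigma>_add(2)[of \<alpha> "\<beta> - \<alpha>"] le_add[of "\<sigma> \<alpha>" "\<sigma> (\<beta> - \<alpha>)"] that by (simp add: \<sigma>C)
  have \<sigma>_subadd: "\<sigma> (min 1 (\<alpha> + \<beta>)) \<preceq> \<sigma> \<alpha> \<boxplus> \<sigma> \<beta>" if "\<alpha> \<in> {0..1}" "\<beta> \<in> {0..1}" for \<alpha> \<beta>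
  proof -
    \<comment> \<open>The part of \<open>\<beta>\<close> that still fits above
      \<open>\<alpha>\<close>, so that \<open>\<alpha> + \<gamma>\<close> is a defined sum and
      \<open>\<sigma>\<close> is additive on it.\<close>
    define \<gamma> where "\<gamma> = min 1 (\<alpha> + \<beta>) - \<alpha>"
    have \<gamma>: "0 \<le> \<gamma>" "\<gamma> \<le> \<beta>" "\<alpha> + \<gamma> \<le> 1" "min 1 (\<alpha> + \<beta>) = \<alpha> + \<gamma>"
      using that by (auto simp: \<gamma>_def)
    have "\<sigma> \<alpha> \<boxplus> \<sigma> \<gamma> \<preceq> \<sigma> \<alpha> \<boxplus> \<sigma> \<beta>"
      using \<gamma> that by (intro add_mono) (auto simp: \<sigma>C le_refl \<sigma>_mono)
    then show ?thesis
      using \<sigma>_add(2)[of \<alpha> \<gamma>] \<gamma> that by simp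
  qed
  \<comment> \<open>Truncated multiples of a positive scalar in \<open>I\<close> would reach
    \<open>1\<close>. Hence distinct scalars stay distinct modulo \<open>I\<close>.\<close>
  have small: "\<sigma> \<delta> \<notin> I" if \<delta>: "0 < \<delta>" "\<delta> \<le> 1" for \<delta>
  proof
    assume "\<sigma> \<delta> \<in> I"
    have mult: "\<sigma> (min 1 (real n * \<delta>)) \<in> I" for n
    proof (induction n)
      case 0
      then show ?case
        by (simp add: \<sigma>0 I)
    next
      case (Suc n)
      let ?s = "min 1 (real n * \<delta>)"
      have "\<sigma> (min 1 (?s + \<delta>)) \<in> I"
        using \<delta> by (intro Ile[OF Iadd[OF Suc \<open>\<sigma> \<delta> \<in> I\<close>] _ \<sigma>_subadd] \<sigma>C) auto
      moreover have "min 1 (?s + \<delta>) = min 1 (real (Suc n) * \<delta>)"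
        using \<delta> by (auto simp: algebra_simps min_def)
      ultimately show ?case
        by simp
    qed
    obtain n where "1 < real n * \<delta>"
      using ex_less_of_nat_mult[OF \<delta>(1)] by blast
    then have "\<^bold>1 \<in> I"
      using mult[of n] \<sigma>1 by simp
    then show False
      using proper I Ile le_one by blast
  qed
  define L U where "L y = {\<alpha> \<in> {0..1}. mv_diff M (\<sigma> \<alpha>) y \<in> I}"
    and "U y = {\<alpha> \<in> {0..1}. mv_diff M y (\<sigma> \<alpha>) \<in> I}" for y
  define h where "h y = Sup (L y)" for y
  \<comment> \<open>Primeness makes the two sets cover \<open>[0,1]\<close>; the triangle inequality
    and \<open>small\<close> then let them share at most one point.\<close>
  have LU: "\<alpha> \<in> L y \<or> \<alpha> \<in> U y" if "y \<in> carrier M" "\<alpha> \<in> {0..1}" for y \<alpha>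
    using maximal_ideal_prime[OF max _ _] that by (auto simp: L_def U_def \<sigma>C)
  have L_le_U: "\<beta> \<le> \<alpha>" if y: "y \<in> carrier M" and "\<beta> \<in> L y" "\<alpha> \<in> U y" for y \<alpha> \<beta>
  proof (rule ccontr)
    assume "\<not> \<beta> \<le> \<alpha>"
    have "mv_diff M (\<sigma> \<beta>) (\<sigma> \<alpha>) \<in> I"
      using that by - (rule Ile[OF Iadd _ diff_triangle[of _ y]], auto simp: L_def U_def \<sigma>C closed)
    then show False
      using small[of "\<beta> - \<alpha>"] \<sigma>_diff[of \<alpha> \<beta>] that \<open>\<not> \<beta> \<le> \<alpha>\<close> by (auto simp: L_def U_def)
  qed
  have L0: "0 \<in> L y" if "y \<in> carrier M" for y
    using that I Ile[of "\<^bold>0"] diff_le[of "\<^bold>0" y] by (simp add: L_def \<sigma>0 closed)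
  have L_le: "\<alpha> \<le> h y" if "\<alpha> \<in> L y" for \<alpha> y
    unfolding h_def using that by (intro cSup_upper bdd_aboveI[of _ 1]) (auto simp: L_def)
  have le_U: "h y \<le> \<alpha>" if "y \<in> carrier M" "\<alpha> \<in> U y" for \<alpha> y
    unfolding h_def using that L0 L_le_U by (intro cSup_least) blast+
  have h01: "0 \<le> h y" "h y \<le> 1" if "y \<in> carrier M" for y
    using L_le[OF L0[OF that]] L0[OF that] unfolding h_def
    by (auto intro!: cSup_least simp: L_def)
  have in_U: "\<alpha> \<in> U y" if "y \<in> carrier M" "h y < \<alpha>" "\<alpha> \<le> 1" for \<alpha> y
    using LU[of y \<alpha>] L_le[of \<alpha> y] h01[of y] that by auto
  have in_L: "\<alpha> \<in> L y" if "y \<in> carrier M" "0 \<le> \<alpha>" "\<alpha> < h y" for \<alpha> y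
    using LU[of y \<alpha>] le_U[of y \<alpha>] h01[of y] that by auto
  \<comment> \<open>A real squeezed between \<open>L y\<close> and \<open>U y\<close> is the value
    of \<open>h\<close>: a gap below it would contain a midpoint belonging to \<open>U y\<close>.
    Values can thus be found without deciding on which side the boundary point lies.\<close>
  have cut: "h y = c" if y: "y \<in> carrier M" and c: "0 \<le> c" "c \<le> 1"
    and "\<And>\<alpha>. \<alpha> \<in> L y \<Longrightarrow> \<alpha> \<le> c" "\<And>\<alpha>. \<alpha> \<in> U y \<Longrightarrow> c \<le> \<alpha>" for y c
  proof (rule antisym)
    show "h y \<le> c"
      unfolding h_def using that L0 by (intro cSup_least) blast+
    show "c \<le> h y"
    proof (rule ccontr)
      assume "\<not> c \<le> h y"
      then have "(h y + c) / 2 \<in> U y"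
        using c by (intro in_U y) auto
      then show False
        using that(5) \<open>\<not> c \<le> h y\<close> by fastforce
    qed
  qed
  have h_neg: "h (\<sim> y) = 1 - h y" if y: "y \<in> carrier M" for y
  proof (rule cut)
    fix \<alpha>
    show "\<alpha> \<le> 1 - h y" if "\<alpha> \<in> L (\<sim> y)"
    proof -
      have "1 - \<alpha> \<in> U y"
        using that y diff_neg_neg[of "\<sigma> (1 - \<alpha>)" y] \<sigma>_neg[of "1 - \<alpha>"]
        by (auto simp: L_def U_def \<sigma>C)
      then show ?thesis
        using le_U[OF y] by fastforce
    qed
    show "1 - h y \<le> \<alpha>" if "\<alpha> \<in> U (\<sim> y)"
    proof -
      have "1 - \<alpha> \<in> L y"
        using that y diff_neg_neg[of y "\<sigma> (1 - \<alpha>)"] \<sigma>_neg[of "1 - \<alpha>"]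
        by (auto simp: L_def U_def \<sigma>C)
      then show ?thesis
        using L_le by fastforce
    qed
  qed (use y h01[OF y] in \<open>auto simp: closed\<close>)
  have h_add: "h (y \<boxplus> z) = min 1 (h y + h z)" if y: "y \<in> carrier M" and z: "z \<in> carrier M" for y z
  proof (rule cut)
    note hyz = h01[OF y] h01[OF z]
    have yz: "y \<boxplus> z \<in> carrier M"
      using y z by (rule add_closed)
    fix \<alpha>
    show "\<alpha> \<le> min 1 (h y + h z)" if \<alpha>: "\<alpha> \<in> L (y \<boxplus> z)"
    proof (rule ccontr)
      assume less: "\<not> \<alpha> \<le> min 1 (h y + h z)"
      have "\<alpha> \<le> 1"
        using \<alpha> by (auto simp: L_def)
      \<comment> \<open>The excess is cut into thirds: two move the scalars strictly above
        \<open>h y\<close> and \<open>h z\<close>, which forces them into \<open>U\<close>, and the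
        third keeps their sum below \<open>\<alpha>\<close>.\<close>
      define e where "e = (\<alpha> - (h y + h z)) / 3"
      have "h y + h z < \<alpha>"
        using less \<open>\<alpha> \<le> 1\<close> by auto
      then have e: "0 < e" "h y + h z + 3 * e = \<alpha>"
        by (simp_all add: e_def field_simps)
      let ?\<beta> = "h y + e" and ?\<gamma> = "h z + e"
      have "?\<beta> \<in> U y" "?\<gamma> \<in> U z"
        using e hyz \<open>\<alpha> \<le> 1\<close> by (auto intro!: in_U y z)
      then have "mv_diff M (y \<boxplus> z) (\<sigma> ?\<beta> \<boxplus> \<sigma> ?\<gamma>) \<in> I"
        using y z by - (rule Ile[OF Iadd _ diff_add_le], auto simp: U_def \<sigma>C closed)
      then have "?\<beta> + ?\<gamma> \<in> U (y \<boxplus> z)"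
        using \<sigma>_add(2)[of ?\<beta> ?\<gamma>] e hyz \<open>\<alpha> \<le> 1\<close> by (simp add: U_def)
      then show False
        using L_le_U[OF yz \<alpha>] e by fastforce
    qed
    show "min 1 (h y + h z) \<le> \<alpha>" if \<alpha>: "\<alpha> \<in> U (y \<boxplus> z)"
    proof (rule ccontr)
      assume less: "\<not> min 1 (h y + h z) \<le> \<alpha>"
      define e where "e = (min 1 (h y + h z) - \<alpha>) / 3"
      have e: "min 1 (h y + h z) = \<alpha> + 3 * e"
        by (simp add: e_def field_simps)
      have "0 < e"
        using less e by linarith
      \<comment> \<open>Again two thirds of the gap are spent and one remains. The maximum handles
        values smaller than \<open>e\<close>, since \<open>0\<close> belongs to every
        \<open>L\<close>.\<close>
      let ?\<beta> = "max 0 (h y - e)" and ?\<gamma> = "max 0 (h z - e)"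
      have \<beta>\<gamma>: "?\<beta> \<in> L y" "?\<gamma> \<in> L z"
        using \<open>0 < e\<close> L0 y z in_L[of y "h y - e"] in_L[of z "h z - e"] by (auto simp: max_def)
      then have B: "?\<beta> \<in> {0..1}" "?\<gamma> \<in> {0..1}" and "min 1 (?\<beta> + ?\<gamma>) \<in> {0..1}"
        by (auto simp: L_def)
      then have C: "\<sigma> ?\<beta> \<in> carrier M" "\<sigma> ?\<gamma> \<in> carrier M" "\<sigma> (min 1 (?\<beta> + ?\<gamma>)) \<in> carrier M"
        using \<sigma>C by blast+
      have "mv_diff M (\<sigma> ?\<beta> \<boxplus> \<sigma> ?\<gamma>) (y \<boxplus> z) \<in> I"
        using y z \<beta>\<gamma> C by - (rule Ile[OF Iadd _ diff_add_le], simp_all add: L_def closed)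
      then have "mv_diff M (\<sigma> (min 1 (?\<beta> + ?\<gamma>))) (y \<boxplus> z) \<in> I"
        using yz C by - (rule Ile[OF _ _ diff_mono[OF _ _ _ \<sigma>_subadd[OF B]]], simp_all add: closed)
      then have "min 1 (?\<beta> + ?\<gamma>) \<in> L (y \<boxplus> z)"
        using \<open>min 1 (?\<beta> + ?\<gamma>) \<in> {0..1}\<close> by (simp add: L_def)
      then have "min 1 (?\<beta> + ?\<gamma>) \<le> \<alpha>"
        by (rule L_le_U[OF yz _ \<alpha>])
      then show False
        using e \<open>0 < e\<close> by linarith
    qed
  qed (use y z h01[OF y] h01[OF z] in \<open>auto simp: closed\<close>)
  have h_I: "h y = 0" if "y \<in> I" for y
  proof -
    have y: "y \<in> carrier M"
      using that I by auto
    then have "0 \<in> U y"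
      using that by (simp add: U_def \<sigma>0 diff_zero)
    then show ?thesis
      using le_U[OF y] h01[OF y] by fastforce
  qed
  have hom: "h \<in> mv_hom M unit_interval_mv"
    using h01 h_add h_neg h_I[OF I(2)] by (auto simp: mv_hom_def unit_interval_mv_simps)
  let ?K = "{x \<in> carrier M. h x = 0}"
  have "mv_maximal_ideal M ?K"
    by (rule unit_hom_kernel_maximal[OF hom])
  then have "I = ?K"
    using max I h_I unfolding mv_maximal_ideal_def by blast
  with hom show ?thesis
    by (rule that)
qed

lemma radical_eq_common_kernel:
  assumes "mv_linear unit_interval_mv M \<sigma>" and "\<sigma> 1 = \<^bold>1"
  shows "mv_radical M = {x \<in> carrier M. \<forall>h\<in>mv_hom M unit_interval_mv. h x = 0}"
proof -
  have "mv_maximal_ideal M I \<longleftrightarrow> (\<exists>h\<in>mv_hom M unit_interval_mv. I = {x \<in> carrier M. h x = 0})" for I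
    using maximal_ideal_eq_unit_hom_kernel[OF assms] unit_hom_kernel_maximal by metis
  then show ?thesis
    by (auto simp: mv_radical_def)
qed

end

section \<open>MV-algebras separated by homomorphisms\<close>

text \<open>Apart from closure, the axioms are equations valid in \<open>[0,1]\<close>, and
  \<open>mv_hom\<close> presupposes no axiom on its source, so separating homomorphisms carry the
  equations back. This is how the quotient by the radical is seen to be an MV-algebra.\<close>

lemma mv_algebra_if_separated:
  assumes closed: "\<And>x y. \<lbrakk>x \<in> carrier M; y \<in> carrier M\<rbrakk> \<Longrightarrow> x \<boxplus>\<^bsub>M\<^esub> y \<in> carrier M"
      "\<And>x. x \<in> carrier M \<Longrightarrow> \<sim>\<^bsub>M\<^esub> x \<in> carrier M" "\<^bold>0\<^bsub>M\<^esub> \<in> carrier M"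
    and sep: "\<And>x y. \<lbrakk>x \<in> carrier M; y \<in> carrier M;
      \<And>h. h \<in> mv_hom M unit_interval_mv \<Longrightarrow> h x = h y\<rbrakk> \<Longrightarrow> x = y"
  shows "mv_algebra M"
proof -
  note h = unit_hom_add unit_hom_neg unit_hom_zero closed
  have bnd: "0 \<le> h x" "h x \<le> 1" if "h \<in> mv_hom M unit_interval_mv" "x \<in> carrier M" for h x
    using that by (rule unit_hom_ge0, rule unit_hom_le1)
  have join: "h (\<sim>\<^bsub>M\<^esub> (\<sim>\<^bsub>M\<^esub> x \<boxplus>\<^bsub>M\<^esub> y) \<boxplus>\<^bsub>M\<^esub> y) = max (h x) (h y)"
    if "h \<in> mv_hom M unit_interval_mv" "x \<in> carrier M" "y \<in> carrier M" for h x y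
    using that bnd[of h x] bnd[of h y] by (simp add: h min_def max_def)
  show ?thesis
  proof
    fix x y z assume xyz: "x \<in> carrier M" "y \<in> carrier M" "z \<in> carrier M"
    show "(x \<boxplus>\<^bsub>M\<^esub> y) \<boxplus>\<^bsub>M\<^esub> z = x \<boxplus>\<^bsub>M\<^esub> (y \<boxplus>\<^bsub>M\<^esub> z)"
    proof (rule sep)
      fix g assume "g \<in> mv_hom M unit_interval_mv"
      then show "g ((x \<boxplus>\<^bsub>M\<^esub> y) \<boxplus>\<^bsub>M\<^esub> z) = g (x \<boxplus>\<^bsub>M\<^esub> (y \<boxplus>\<^bsub>M\<^esub> z))"
        using xyz bnd[of g x] bnd[of g z] by (simp add: h min_def)
    qed (use xyz in \<open>simp_all add: closed\<close>)
  next
    fix x y assume "x \<in> carrier M" "y \<in> carrier M"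
    then show "x \<boxplus>\<^bsub>M\<^esub> y = y \<boxplus>\<^bsub>M\<^esub> x"
      and "\<sim>\<^bsub>M\<^esub> (\<sim>\<^bsub>M\<^esub> x \<boxplus>\<^bsub>M\<^esub> y) \<boxplus>\<^bsub>M\<^esub> y = \<sim>\<^bsub>M\<^esub> (\<sim>\<^bsub>M\<^esub> y \<boxplus>\<^bsub>M\<^esub> x) \<boxplus>\<^bsub>M\<^esub> x"
      by (intro sep; simp add: join closed max.commute; simp add: h add.commute)+
  next
    fix x assume "x \<in> carrier M"
    then show "x \<boxplus>\<^bsub>M\<^esub> \<^bold>0\<^bsub>M\<^esub> = x" "\<sim>\<^bsub>M\<^esub> (\<sim>\<^bsub>M\<^esub> x) = x" "x \<boxplus>\<^bsub>M\<^esub> \<sim>\<^bsub>M\<^esub> \<^bold>0\<^bsub>M\<^esub> = \<sim>\<^bsub>M\<^esub> \<^bold>0\<^bsub>M\<^esub>"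
      by (intro sep; simp add: h bnd)+
  qed (use closed in auto)
qed

text \<open>The working form of semisimplicity: values replace a representing space, which is
  recovered only in \<open>semisimple\<close>.\<close>

locale separated_mv_algebra = mv_algebra M
  for M :: "('a, 'm) mv_scheme" (structure) +
  assumes sep: "\<lbrakk>x \<in> carrier M; y \<in> carrier M;
    \<And>h. h \<in> mv_hom M unit_interval_mv \<Longrightarrow> h x = h y\<rbrakk> \<Longrightarrow> x = y"
begin

lemma le_iff_hom_le:
  assumes x: "x \<in> carrier M" and y: "y \<in> carrier M"
  shows "x \<preceq> y \<longleftrightarrow> (\<forall>h\<in>mv_hom M unit_interval_mv. h x \<le> h y)"
proof
  show "\<forall>h\<in>mv_hom M unit_interval_mv. h x \<le> h y" if "x \<preceq> y"
    using unit_hom_mono x y that by blast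
  show "x \<preceq> y" if "\<forall>h\<in>mv_hom M unit_interval_mv. h x \<le> h y"
    unfolding mv_le_def
    using that x y by (intro sep) (simp_all add: closed unit_hom_add unit_hom_neg unit_hom_one)
qed

text \<open>Under each homomorphism \<open>f\<close> is a constant multiple of a real linear map, so
  the values of a partial sum add exactly; as their total is itself a value of \<open>h\<close>, it
  is at most \<open>1\<close> and nothing is truncated. The freedom in \<open>c\<close> and
  \<open>g\<close> covers both arguments of the product and of the scalar multiplication.\<close>

lemma mv_linear_if_scaled:
  assumes A: "mv_algebra A" and f: "f \<in> carrier A \<rightarrow> carrier M"
    and g: "\<And>h. h \<in> mv_hom M unit_interval_mv \<Longrightarrow> mv_linear A unit_interval_mv (g h)"
    and c: "\<And>h. h \<in> mv_hom M unit_interval_mv \<Longrightarrow> c h \<in> {0..1}"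
    and fg: "\<And>h x. \<lbrakk>h \<in> mv_hom M unit_interval_mv; x \<in> carrier A\<rbrakk> \<Longrightarrow> h (f x) = c h * g h x"
  shows "mv_linear A M f"
  unfolding mv_linear_def
proof (intro conjI ballI impI)
  fix x y assume x: "x \<in> carrier A" and y: "y \<in> carrier A" and le: "x \<preceq>\<^bsub>A\<^esub> \<sim>\<^bsub>A\<^esub> y"
  have xy: "x \<boxplus>\<^bsub>A\<^esub> y \<in> carrier A"
    using A x y by (rule mv_algebra.add_closed)
  have fC: "f x \<in> carrier M" "f y \<in> carrier M" "f (x \<boxplus>\<^bsub>A\<^esub> y) \<in> carrier M"
    using f x y xy by auto
  have sum: "h (f x) + h (f y) = h (f (x \<boxplus>\<^bsub>A\<^esub> y))"
    if h: "h \<in> mv_hom M unit_interval_mv" for h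
    using fg[OF h] x y xy unit_linear_add[OF g[OF h] x y le] by (simp add: distrib_left)
  show "f x \<preceq> \<sim> (f y)"
  proof (subst le_iff_hom_le)
    show "\<forall>h\<in>mv_hom M unit_interval_mv. h (f x) \<le> h (\<sim> (f y))"
      using fC sum unit_hom_le1[OF _ fC(3)] by (fastforce simp: unit_hom_neg)
  qed (use fC in \<open>simp_all add: closed\<close>)
  show "f (x \<boxplus>\<^bsub>A\<^esub> y) = f x \<boxplus> f y"
    using fC sum unit_hom_le1[OF _ fC(3)] by (intro sep) (simp_all add: closed unit_hom_add)
qed (use f in auto)

lemma unital_fmv_algebra_if_hom_mult:
  fixes mult :: "'a \<Rightarrow> 'a \<Rightarrow> 'a" and scal :: "real \<Rightarrow> 'a \<Rightarrow> 'a"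
  assumes mult: "\<And>x y. \<lbrakk>x \<in> carrier M; y \<in> carrier M\<rbrakk> \<Longrightarrow> mult x y \<in> carrier M"
    "\<And>h x y. \<lbrakk>h \<in> mv_hom M unit_interval_mv; x \<in> carrier M; y \<in> carrier M\<rbrakk>
      \<Longrightarrow> h (mult x y) = h x * h y"
    and scal: "\<And>\<alpha> x. \<lbrakk>\<alpha> \<in> {0..1}; x \<in> carrier M\<rbrakk> \<Longrightarrow> scal \<alpha> x \<in> carrier M"
    "\<And>h \<alpha> x. \<lbrakk>h \<in> mv_hom M unit_interval_mv; \<alpha> \<in> {0..1}; x \<in> carrier M\<rbrakk>
      \<Longrightarrow> h (scal \<alpha> x) = \<alpha> * h x"
  shows "unital_fmv_algebra M mult scal"
proof
  have hom01: "h x \<in> {0..1}" if "h \<in> mv_hom M unit_interval_mv" "x \<in> carrier M" for h x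
    using unit_hom_ge0[OF that] unit_hom_le1[OF that] by simp
  show "mv_bilinear M M M mult"
    unfolding mv_bilinear_def
  proof (intro conjI ballI)
    fix a assume a: "a \<in> carrier M"
    show "mv_linear M M (mult a)"
      using a mult hom01
      by (intro mv_linear_if_scaled[where g = "\<lambda>h. h" and c = "\<lambda>h. h a"])
        (auto intro: unit_hom_linear mv_algebra_axioms)
    show "mv_linear M M (\<lambda>b. mult b a)"
      using a mult hom01
      by (intro mv_linear_if_scaled[where g = "\<lambda>h. h" and c = "\<lambda>h. h a"])
        (auto intro: unit_hom_linear mv_algebra_axioms simp: mult.commute)
  qed
  have id: "mv_linear unit_interval_mv unit_interval_mv (\<lambda>\<alpha>. \<alpha>)"
    by (auto simp: mv_linear_def unit_interval_mv_le)
  show "mv_bilinear unit_interval_mv M M scal"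
    unfolding mv_bilinear_def
  proof (intro conjI ballI)
    fix \<alpha> assume \<alpha>: "\<alpha> \<in> carrier unit_interval_mv"
    then show "mv_linear M M (scal \<alpha>)"
      using scal
      by (intro mv_linear_if_scaled[where g = "\<lambda>h. h" and c = "\<lambda>h. \<alpha>"])
        (auto intro: unit_hom_linear mv_algebra_axioms simp: unit_interval_mv_simps)
  next
    fix x assume x: "x \<in> carrier M"
    then show "mv_linear unit_interval_mv M (\<lambda>\<alpha>. scal \<alpha> x)"
      using scal hom01
      by (intro mv_linear_if_scaled[where g = "\<lambda>h \<alpha>. \<alpha>" and c = "\<lambda>h. h x"])
        (auto intro: id mv_algebra_unit_interval simp: unit_interval_mv_simps mult.commute)
  qed
qed (auto intro!: sep simp: mult scal mult_le_one unit_hom_one closed)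

text \<open>The representing space is the closed subspace of homomorphisms in the Tychonoff cube
  \<open>[0,1]\<close> to the power \<open>carrier M\<close>.\<close>

lemma semisimple: "mv_semisimple M"
proof -
  define C where "C = product_topology (\<lambda>_. top_of_set {0..1::real}) (carrier M)"
  define K where "K = mv_hom M unit_interval_mv \<inter> extensional (carrier M)"
  define X where "X = subtopology C K"
  have topC: "topspace C = carrier M \<rightarrow>\<^sub>E {0..1}"
    by (simp add: C_def)
  have proj: "continuous_map C euclideanreal (\<lambda>x. x a)" if "a \<in> carrier M" for a
    using continuous_map_product_projection[OF that, of "\<lambda>_. top_of_set {0..1::real}"]
    unfolding C_def by (rule continuous_map_into_fulltopology)
  have cl: "closedin C {x \<in> topspace C. f x = g x}"
    if "continuous_map C euclideanreal f" "continuous_map C euclideanreal g" for f g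
    using that by (rule closedin_continuous_maps_eq[OF Hausdorff_space_euclidean])
  \<comment> \<open>One closed set for each instance of a homomorphism equation, since both sides
    are continuous in the coordinates; their intersection is \<open>K\<close>.\<close>
  define F where "F = {topspace C, {x \<in> topspace C. x \<^bold>0 = 0}} \<union>
    (\<lambda>a. {x \<in> topspace C. x (\<sim> a) = 1 - x a}) ` carrier M \<union>
    (\<lambda>(a, b). {x \<in> topspace C. x (a \<boxplus> b) = min 1 (x a + x b)}) ` (carrier M \<times> carrier M)"
  have "closedin C (\<Inter> F)"
    unfolding F_def
    by (intro closedin_Inter) (auto intro!: cl continuous_intros proj simp: closed)
  moreover have K: "K = \<Inter> F"
    unfolding F_def K_def topC
    by (auto simp: mv_hom_def unit_interval_mv_simps PiE_iff Pi_iff extensional_def)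
  moreover have "compact_space C"
    by (simp add: C_def compact_space_product_topology compact_space_subtopology)
  ultimately have compX: "compact_space X"
    unfolding X_def by (simp add: closedin_compact_space compact_space_subtopology)
  have "Hausdorff_space C"
    by (simp add: C_def Hausdorff_space_product_topology Hausdorff_space_subtopology)
  then have T2: "Hausdorff_space X"
    unfolding X_def by (rule Hausdorff_space_subtopology)
  have topX: "topspace X = K"
    unfolding X_def by (auto simp: K F_def)
  have Khom: "x \<in> mv_hom M unit_interval_mv" if "x \<in> K" for x
    using that by (simp add: K_def)
  \<comment> \<open>Evaluation at \<open>a\<close>, as in a Gelfand transform, cut down to
    \<open>K\<close> because members of \<open>cont_mv\<close> are extensional.\<close>
  define r where "r a = (\<lambda>x\<in>K. x a)" for a
  define S where "S = r ` carrier M"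
  have r_cont: "r a \<in> carrier (cont_mv X)" if a: "a \<in> carrier M" for a
  proof -
    have "continuous_map X euclideanreal (\<lambda>x. x a)"
      unfolding X_def by (intro continuous_map_from_subtopology proj a)
    then have "continuous_map X euclideanreal (r a)"
      by (rule continuous_map_eq) (simp add: r_def topX)
    then show ?thesis
      using unit_hom_ge0[OF Khom a] unit_hom_le1[OF Khom a]
      by (auto simp: cont_mv_def topX r_def)
  qed
  have r_zero: "r \<^bold>0 = \<^bold>0\<^bsub>cont_mv X\<^esub>"
    by (auto simp: cont_mv_def r_def topX unit_interval_mv_simps unit_hom_zero[OF Khom])
  have r_neg: "r (\<sim> a) = \<sim>\<^bsub>cont_mv X\<^esub> (r a)" if "a \<in> carrier M" for a
    using that
    by (auto simp: cont_mv_def r_def topX unit_interval_mv_simps unit_hom_neg[OF Khom])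
  have r_add: "r (a \<boxplus> b) = r a \<boxplus>\<^bsub>cont_mv X\<^esub> r b" if "a \<in> carrier M" "b \<in> carrier M" for a b
    using that
    by (auto simp: cont_mv_def r_def topX unit_interval_mv_simps unit_hom_add[OF Khom])
  have sub: "mv_subalgebra S (cont_mv X)"
    unfolding mv_subalgebra_def S_def
    by (auto simp: r_cont r_zero[symmetric] r_neg[symmetric] r_add[symmetric] closed)
  have "\<exists>f\<in>S. f x \<noteq> f y" if xy: "x \<in> topspace X" "y \<in> topspace X" "x \<noteq> y" for x y
  proof -
    obtain a where "a \<in> carrier M" "x a \<noteq> y a"
      using xy extensionalityI[of x "carrier M" y] by (auto simp: topX K_def)
    then show ?thesis
      using xy by (auto simp: S_def r_def topX)
  qed
  moreover have "r \<in> mv_hom M ((cont_mv X)\<lparr>carrier := S\<rparr>)"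
    by (auto simp: mv_hom_def S_def r_zero r_neg r_add)
  moreover have "inj_on r (carrier M)"
  proof (intro inj_onI sep)
    fix a b h assume ab: "a \<in> carrier M" "b \<in> carrier M" "r a = r b"
      and h: "h \<in> mv_hom M unit_interval_mv"
    \<comment> \<open>Points of \<open>K\<close> are extensional, so \<open>h\<close> is replaced by
      its restriction, which has the same values at \<open>a\<close> and \<open>b\<close>.\<close>
    have "restrict h (carrier M) \<in> K"
      using h by (auto simp: K_def mv_hom_def closed)
    then show "h a = h b"
      using fun_cong[OF ab(3), of "restrict h (carrier M)"] ab by (simp add: r_def)
  qed auto
  ultimately show ?thesis
    unfolding mv_semisimple_def
    using compX T2 sub by (intro exI[of _ X] exI[of _ S] exI[of _ r]) (simp add: S_def bij_betw_def)
qed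

end

subsection \<open>The quotient by the radical\<close>

text \<open>The sum of the two opposite differences has value \<open>\<bar>h x - h y\<bar>\<close>
  under \<open>h\<close>, so congruence modulo the radical means that no homomorphism tells the
  elements apart. Every homomorphism is therefore constant on classes and descends to
  \<open>N\<close>, and the descended ones separate.\<close>

lemma (in mv_algebra)
  fixes N \<theta>
  defines "\<theta> \<equiv> mv_ideal_rel M (mv_radical M)"
  defines "N \<equiv> mv_quot M \<theta>"
  assumes rad: "mv_radical M = {x \<in> carrier M. \<forall>h\<in>mv_hom M unit_interval_mv. h x = 0}"
  shows radical_quotient_separated: "separated_mv_algebra N"
    and radical_quotient_hom: "g \<in> mv_hom N unit_interval_mv
      \<Longrightarrow> (\<lambda>x. g (\<theta> `` {x})) \<in> mv_hom M unit_interval_mv"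
proof -
  have rel: "(x, y) \<in> \<theta> \<longleftrightarrow> x \<in> carrier M \<and> y \<in> carrier M \<and>
    (\<forall>h\<in>mv_hom M unit_interval_mv. h x = h y)" for x y
    unfolding \<theta>_def mv_ideal_rel_def rad
    by (auto simp: unit_hom_add unit_hom_diff closed min_def max_def split: if_splits)
  have cong: "mv_congruence M \<theta>"
    unfolding mv_congruence_def
  proof (intro conjI allI impI)
    show "equiv (carrier M) \<theta>"
      by (auto simp: equiv_def refl_on_def sym_def trans_def rel)
  next
    fix x x' y y'
    assume "(x, x') \<in> \<theta>" "(y, y') \<in> \<theta>"
    then show "(x \<boxplus> y, x' \<boxplus> y') \<in> \<theta>"
      by (simp add: rel closed unit_hom_add) metis
  qed (simp add: rel closed unit_hom_neg)
  note Q = mv_quot_carrier mv_quot_zero mv_quot_neg[OF cong] mv_quot_add[OF cong]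
  show "(\<lambda>x. g (\<theta> `` {x})) \<in> mv_hom M unit_interval_mv" if "g \<in> mv_hom N unit_interval_mv" for g
    using that unfolding mv_hom_def N_def by (auto simp: Q Pi_iff)
  have lift: "\<exists>g\<in>mv_hom N unit_interval_mv. \<forall>x\<in>carrier M. g (\<theta> `` {x}) = h x"
    if h: "h \<in> mv_hom M unit_interval_mv" for h
  proof -
    define g where "g U = h (SOME t. t \<in> U)" for U
    have g: "g (\<theta> `` {x}) = h x" if "x \<in> carrier M" for x
    proof -
      have "x \<in> \<theta> `` {x}"
        using that by (simp add: rel)
      then have "(x, SOME t. t \<in> \<theta> `` {x}) \<in> \<theta>"
        unfolding Image_singleton_iff[symmetric] by (rule someI)
      then show ?thesis
        using h unfolding g_def rel by metis
    qed
    then have "g \<in> mv_hom N unit_interval_mv"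
      using h unfolding mv_hom_def N_def by (auto simp: Q closed)
    with g show ?thesis
      by blast
  qed
  have sepN: "U = V" if UV: "U \<in> carrier N" "V \<in> carrier N"
    "\<And>g. g \<in> mv_hom N unit_interval_mv \<Longrightarrow> g U = g V" for U V
  proof -
    obtain x y where xy: "x \<in> carrier M" "U = \<theta> `` {x}" "y \<in> carrier M" "V = \<theta> `` {y}"
      using UV(1,2) by (auto simp: N_def Q)
    have "h x = h y" if "h \<in> mv_hom M unit_interval_mv" for h
      using lift[OF that] UV(3) xy by metis
    then show ?thesis
      using xy mv_quot_eq[OF cong] by (simp add: rel)
  qed
  have "mv_algebra N"
    using sepN by (rule mv_algebra_if_separated[rotated 3]) (auto simp: N_def Q closed)
  then show "separated_mv_algebra N"
    using sepN by (simp add: separated_mv_algebra_def separated_mv_algebra_axioms_def)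
qed

section \<open>Homomorphisms on the tensor product\<close>

text \<open>The join is the partial sum of \<open>mv_diff M x y\<close> and \<open>y\<close>, so
  linearity computes \<open>f\<close> on differences. Negation is \<open>1\<close> minus
  \<open>x\<close>, and \<open>x \<boxplus> y\<close> is the negation of \<open>\<sim> x\<close>
  minus \<open>y\<close>, so differences suffice.\<close>

lemma (in mv_algebra) unit_hom_if_linear_join:
  assumes f: "mv_linear M unit_interval_mv f" and f1: "f \<^bold>1 = 1"
    and join: "\<And>x y. \<lbrakk>x \<in> carrier M; y \<in> carrier M\<rbrakk> \<Longrightarrow> f (mv_join M x y) = max (f x) (f y)"
  shows "f \<in> mv_hom M unit_interval_mv"
proof -
  have diff: "f (mv_diff M x y) = max 0 (f x - f y)" if xy: "x \<in> carrier M" "y \<in> carrier M" for x y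
  proof -
    have "mv_diff M x y \<preceq> \<sim> y"
      using xy le_neg_diff[of y x] by (simp add: le_neg_iff closed)
    then have "f (mv_diff M x y \<boxplus> y) = f (mv_diff M x y) + f y"
      using xy by (intro unit_linear_add[OF f]) (simp_all add: closed)
    moreover have "mv_diff M x y \<boxplus> y = mv_join M x y"
      by (simp add: mv_diff_def mv_join_def)
    ultimately show ?thesis
      using join[OF xy] by simp
  qed
  have neg: "f (\<sim> x) = 1 - f x" if x: "x \<in> carrier M" for x
  proof -
    have "\<sim> x = mv_diff M \<^bold>1 x"
      using x by (simp add: mv_diff_def neg_one zero_add)
    then show ?thesis
      using x diff[of "\<^bold>1" x] f1 unit_linear_le1[OF f x] by (simp add: closed)
  qed
  have "f (x \<boxplus> y) = min 1 (f x + f y)" if xy: "x \<in> carrier M" "y \<in> carrier M" for x y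
  proof -
    have "x \<boxplus> y = \<sim> (mv_diff M (\<sim> x) y)"
      using xy by (simp add: mv_diff_def neg_neg closed)
    then show ?thesis
      using xy by (simp add: neg diff closed min_def max_def)
  qed
  moreover have "f \<^bold>0 = 0"
    using neg[of "\<^bold>1"] f1 by (simp add: neg_one closed)
  ultimately show ?thesis
    using neg unit_linear_ge0[OF f] unit_linear_le1[OF f]
    by (simp add: mv_hom_def unit_interval_mv_simps)
qed

lemma (in mv_algebra) unit_hom_join:
  assumes "h \<in> mv_hom M unit_interval_mv" "x \<in> carrier M" "y \<in> carrier M"
  shows "h (mv_join M x y) = max (h x) (h y)"
  using assms unit_hom_le1[OF assms(1,2)] unit_hom_le1[OF assms(1,3)]
  by (simp add: mv_join_def unit_hom_add unit_hom_neg closed min_def max_def)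

text \<open>Preservation of joins and of \<open>1\<close> makes the two one-variable maps
  homomorphisms. For the factorization, monotonicity in the first argument bounds
  \<open>h (\<beta> a y)\<close> by \<open>h (\<beta> 1 y)\<close>, so the linear functional at
  \<open>a\<close> vanishes on the kernel of the one at \<open>1\<close>.\<close>

lemma unit_hom_bimorphism:
  assumes A: "mv_algebra A" and B: "mv_algebra B" and M: "mv_algebra M"
    and \<beta>: "mv_bimorphism A B M \<beta>" and h: "h \<in> mv_hom M unit_interval_mv"
  shows "(\<lambda>a. h (\<beta> a \<^bold>1\<^bsub>B\<^esub>)) \<in> mv_hom A unit_interval_mv"
    and "(\<lambda>b. h (\<beta> \<^bold>1\<^bsub>A\<^esub> b)) \<in> mv_hom B unit_interval_mv"
    and "\<lbrakk>a \<in> carrier A; b \<in> carrier B\<rbrakk>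
      \<Longrightarrow> h (\<beta> a b) = h (\<beta> a \<^bold>1\<^bsub>B\<^esub>) * h (\<beta> \<^bold>1\<^bsub>A\<^esub> b)"
proof -
  interpret A: mv_algebra A by (rule A)
  interpret B: mv_algebra B by (rule B)
  interpret M: mv_algebra M by (rule M)
  have C: "\<beta> a b \<in> carrier M" if "a \<in> carrier A" "b \<in> carrier B" for a b
    using mv_bimorphism_closed[OF \<beta> that] .
  have linB: "mv_linear B unit_interval_mv (\<lambda>b. h (\<beta> a b))" if "a \<in> carrier A" for a
    using \<beta> that C by (intro mv_linear_compose[OF _ M.unit_hom_linear[OF h]])
      (auto simp: mv_bimorphism_def mv_bilinear_def)
  have linA: "mv_linear A unit_interval_mv (\<lambda>a. h (\<beta> a b))" if "b \<in> carrier B" for b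
    using \<beta> that C by (intro mv_linear_compose[OF _ M.unit_hom_linear[OF h]])
      (auto simp: mv_bimorphism_def mv_bilinear_def)
  have one: "h (\<beta> \<^bold>1\<^bsub>A\<^esub> \<^bold>1\<^bsub>B\<^esub>) = 1"
    using \<beta> by (simp add: mv_bimorphism_def M.unit_hom_one[OF h])
  show "(\<lambda>a. h (\<beta> a \<^bold>1\<^bsub>B\<^esub>)) \<in> mv_hom A unit_interval_mv"
    using \<beta> linA one
    by (intro A.unit_hom_if_linear_join)
      (simp_all add: mv_bimorphism_def B.closed M.unit_hom_join[OF h] C)
  show hom: "(\<lambda>b. h (\<beta> \<^bold>1\<^bsub>A\<^esub> b)) \<in> mv_hom B unit_interval_mv"
    using \<beta> linB one
    by (intro B.unit_hom_if_linear_join)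
      (simp_all add: mv_bimorphism_def A.closed M.unit_hom_join[OF h] C)
  assume a: "a \<in> carrier A" and b: "b \<in> carrier B"
  have "h (\<beta> a y) = 0" if "y \<in> carrier B" "h (\<beta> \<^bold>1\<^bsub>A\<^esub> y) = 0" for y
    using A.unit_linear_mono[OF linA, of y a "\<^bold>1\<^bsub>A\<^esub>"] that a
      unit_linear_ge0[OF linA[OF that(1)] a]
    by (simp add: A.le_one A.closed)
  then show "h (\<beta> a b) = h (\<beta> a \<^bold>1\<^bsub>B\<^esub>) * h (\<beta> \<^bold>1\<^bsub>A\<^esub> b)"
    by (rule B.unit_linear_eq_scaled_hom[OF linB[OF a] hom _ b])
qed

text \<open>By monotonicity \<open>h (mult a y)\<close> is at most
  \<open>h (mult 1 y) = h y\<close>, which gives the kernel condition; the unit law identifies the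
  factor \<open>h (mult a 1)\<close> as \<open>h a\<close>.\<close>

lemma (in unital_pmv_algebra) unit_hom_mult:
  assumes h: "h \<in> mv_hom M unit_interval_mv" and a: "a \<in> carrier M" and b: "b \<in> carrier M"
  shows "h (mult a b) = h a * h b"
proof -
  have C: "mult x y \<in> carrier M" if "x \<in> carrier M" "y \<in> carrier M" for x y
    using mult_bilinear that by (auto simp: mv_bilinear_def mv_linear_def Pi_iff)
  have lin1: "mv_linear M unit_interval_mv (\<lambda>y. h (mult x y))" if "x \<in> carrier M" for x
    using mult_bilinear that C
    by (intro mv_linear_compose[OF _ unit_hom_linear[OF h]]) (auto simp: mv_bilinear_def)
  have lin2: "mv_linear M unit_interval_mv (\<lambda>x. h (mult x y))" if "y \<in> carrier M" for y
    using mult_bilinear that C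
    by (intro mv_linear_compose[OF _ unit_hom_linear[OF h]]) (auto simp: mv_bilinear_def)
  have "h (mult a y) = 0" if "y \<in> carrier M" "h y = 0" for y
    using unit_linear_mono[OF lin2, of y a "\<^bold>1"] that a unit_linear_ge0[OF lin2[OF that(1)] a]
    by (simp add: le_one closed mult_one_left)
  then have "h (mult a b) = h (mult a \<^bold>1) * h b"
    by (rule unit_linear_eq_scaled_hom[OF lin1[OF a] h _ b])
  then show ?thesis
    using a by (simp add: mult_one_right)
qed

lemma (in riesz_mv_algebra) scal_linear:
  assumes "x \<in> carrier M"
  shows "mv_linear unit_interval_mv M (\<lambda>\<alpha>. scal \<alpha> x)"
  using scal_bilinear assms by (simp add: mv_bilinear_def)

lemma (in riesz_mv_algebra) scal_closed: "\<lbrakk>\<alpha> \<in> {0..1}; x \<in> carrier M\<rbrakk> \<Longrightarrow> scal \<alpha> x \<in> carrier M"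
  using scal_linear[of x] by (auto simp: mv_linear_def unit_interval_mv_simps)

text \<open>The scaling principle on the MV-algebra \<open>[0,1]\<close> itself, with the identity
  as homomorphism. Its kernel is \<open>{0}\<close>, where the functional vanishes by additivity at
  \<open>0 + 0\<close>.\<close>

lemma (in riesz_mv_algebra) unit_hom_scal:
  assumes h: "h \<in> mv_hom M unit_interval_mv" and x: "x \<in> carrier M" and \<alpha>: "\<alpha> \<in> {0..1}"
  shows "h (scal \<alpha> x) = \<alpha> * h x"
proof -
  have lin: "mv_linear unit_interval_mv unit_interval_mv (\<lambda>\<alpha>. h (scal \<alpha> x))"
    by (rule mv_linear_compose[OF scal_linear[OF x] unit_hom_linear[OF h]])
      (simp add: scal_closed x unit_interval_mv_simps)
  have id: "(\<lambda>\<alpha>. \<alpha>) \<in> mv_hom unit_interval_mv unit_interval_mv"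
    by (simp add: mv_hom_def)
  have "h (scal 0 x) = 0"
    using unit_linear_add[OF lin, of 0 0]
    by (simp add: unit_interval_mv_simps unit_interval_mv_le)
  then show ?thesis
    using mv_algebra.unit_linear_eq_scaled_hom[OF mv_algebra_unit_interval lin id, of \<alpha>] \<alpha> x
    by (simp add: unit_interval_mv_simps scal_one mult.commute)
qed

section \<open>Elements of the tensor product with multiplicative values\<close>

lemma mv_tensor_induct [consumes 3, case_names pure zero neg add]:
  assumes A: "mv_algebra A" and B: "mv_algebra B" and x: "x \<in> carrier (mv_tensor A B)"
    and pure: "\<And>a b. \<lbrakk>a \<in> carrier A; b \<in> carrier B\<rbrakk> \<Longrightarrow> Q (mv_tensor_pure A B a b)"
    and zero: "Q \<^bold>0\<^bsub>mv_tensor A B\<^esub>"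
    and neg: "\<And>x. \<lbrakk>x \<in> carrier (mv_tensor A B); Q x\<rbrakk> \<Longrightarrow> Q (\<sim>\<^bsub>mv_tensor A B\<^esub> x)"
    and add: "\<And>x y. \<lbrakk>x \<in> carrier (mv_tensor A B); y \<in> carrier (mv_tensor A B); Q x; Q y\<rbrakk>
      \<Longrightarrow> Q (x \<boxplus>\<^bsub>mv_tensor A B\<^esub> y)"
  shows "Q x"
proof -
  let ?F = "mv_terms (carrier A \<times> carrier B)" and ?\<Theta> = "mv_tensor_rel A B"
  have cong: "mv_congruence ?F ?\<Theta>"
    using mv_tensor_rel_in_congs[OF A B] by (simp add: mv_tensor_congs_def)
  note S = mv_quot_carrier mv_quot_zero mv_quot_neg[OF cong] mv_quot_add[OF cong] mv_terms_simps
  have "Q (?\<Theta> `` {t})" if "t \<in> carrier ?F" for t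
    using that
  proof (induction t)
    case (Gen g)
    then show ?case
      using pure by (cases g) (simp add: mv_tensor_pure_def mv_terms_simps)
  next
    case Zero_term
    then show ?case
      using zero by (simp add: mv_tensor_def S)
  next
    case (Neg_term t)
    then show ?case
      using neg[of "?\<Theta> `` {t}"] by (simp add: mv_tensor_def S)
  next
    case (Add_term s t)
    then show ?case
      using add[of "?\<Theta> `` {s}" "?\<Theta> `` {t}"] by (simp add: mv_tensor_def S)
  qed
  then show ?thesis
    using x by (auto simp: mv_tensor_def mv_quot_carrier)
qed

text \<open>If \<open>g\<close> times every pure tensor exists, then so does \<open>g\<close> times every element, since
  \<open>g * (1 - x) = g - g * x\<close> and \<open>g * min 1 (x + y) = min g (g * x + g * y)\<close>. This applies first
  to pure \<open>g\<close> and then, by commutativity, to all \<open>g\<close>.\<close>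

lemma mv_tensor_mult_ex:
  fixes A B
  defines "T \<equiv> mv_tensor A B"
  assumes A: "unital_pmv_algebra A mult_A" and B: "unital_pmv_algebra B mult_B"
    and s: "s \<in> carrier T" and t: "t \<in> carrier T"
  shows "\<exists>u\<in>carrier T. \<forall>h\<in>mv_hom T unit_interval_mv. h u = h s * h t"
proof -
  interpret A: unital_pmv_algebra A mult_A by (rule A)
  interpret B: unital_pmv_algebra B mult_B by (rule B)
  note AB = A.mv_algebra_axioms B.mv_algebra_axioms
  interpret T: mv_algebra T
    unfolding T_def by (rule mv_tensor_universal[OF AB])
  let ?p = "mv_tensor_pure A B"
  have bim: "mv_bimorphism A B T ?p"
    unfolding T_def by (rule mv_tensor_universal[OF AB])
  note bound = unit_hom_ge0[of _ T] unit_hom_le1[of _ T]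
  have extend: "\<exists>u\<in>carrier T. \<forall>h\<in>mv_hom T unit_interval_mv. h u = h g * h x"
    if g: "g \<in> carrier T" and x: "x \<in> carrier T"
      and pure: "\<And>a b. \<lbrakk>a \<in> carrier A; b \<in> carrier B\<rbrakk>
        \<Longrightarrow> \<exists>u\<in>carrier T. \<forall>h\<in>mv_hom T unit_interval_mv. h u = h g * h (?p a b)" for g x
    using AB x[unfolded T_def]
  proof (induction rule: mv_tensor_induct)
    case (pure a b)
    then show ?case
      by (rule that(3))
  next
    case zero
    have "\<forall>h\<in>mv_hom T unit_interval_mv. h \<^bold>0\<^bsub>T\<^esub> = h g * h \<^bold>0\<^bsub>T\<^esub>"
      by (simp add: unit_hom_zero)
    then show ?case
      unfolding T_def[symmetric] using T.zero_closed by blast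
  next
    case (neg x)
    note neg = neg[folded T_def]
    then obtain u where u: "u \<in> carrier T" "\<forall>h\<in>mv_hom T unit_interval_mv. h u = h g * h x"
      by blast
    have "h (mv_diff T g u) = h g * h (\<sim>\<^bsub>T\<^esub> x)" if h: "h \<in> mv_hom T unit_interval_mv" for h
    proof -
      have "h g * h x \<le> h g"
        using bound[OF h] g neg(1) by (simp add: mult_left_le)
      then show ?thesis
        using h u g neg(1) by (simp add: T.unit_hom_diff unit_hom_neg algebra_simps)
    qed
    then show ?case
      unfolding T_def[symmetric] using T.diff_closed[OF g u(1)] by blast
  next
    case (add x y)
    note add = add[folded T_def]
    then obtain u v where uv: "u \<in> carrier T" "v \<in> carrier T"
      "\<forall>h\<in>mv_hom T unit_interval_mv. h u = h g * h x"
      "\<forall>h\<in>mv_hom T unit_interval_mv. h v = h g * h y"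
      by blast
    \<comment> \<open>Subtracting twice from \<open>g\<close> expresses the meet of \<open>g\<close>
      and \<open>u \<boxplus> v\<close>, hence the value
      \<open>min (h g) (h u + h v)\<close>.\<close>
    define w where "w = mv_diff T g (mv_diff T g (u \<boxplus>\<^bsub>T\<^esub> v))"
    have "h w = h g * h (x \<boxplus>\<^bsub>T\<^esub> y)" if h: "h \<in> mv_hom T unit_interval_mv" for h
    proof -
      have g01: "0 \<le> h g" "h g \<le> 1"
        using bound[OF h] g by auto
      have "h w = max 0 (h g - max 0 (h g - min 1 (h u + h v)))"
        using h uv(1,2) g by (simp add: w_def T.unit_hom_diff unit_hom_add T.closed)
      also have "\<dots> = min (h g) (h u + h v)"
        using g01 bound[OF h uv(1)] bound[OF h uv(2)] by (auto simp: min_def max_def)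
      also have "\<dots> = min (h g) (h g * h x + h g * h y)"
        using h uv(3,4) by simp
      also have "\<dots> = h g * min 1 (h x + h y)"
        using g01 by (simp add: min_mult_distrib_left distrib_left)
      finally show ?thesis
        using h add(1,2) by (simp add: unit_hom_add)
    qed
    moreover have "w \<in> carrier T"
      using g uv by (simp add: w_def T.closed)
    ultimately show ?case
      unfolding T_def[symmetric] by blast
  qed
  have pure_closed: "?p a b \<in> carrier T" if "a \<in> carrier A" "b \<in> carrier B" for a b
    using mv_bimorphism_closed[OF bim that] .
  have pure_pure: "\<exists>u\<in>carrier T. \<forall>h\<in>mv_hom T unit_interval_mv. h u = h (?p a b) * h (?p a' b')"
    if "a \<in> carrier A" "b \<in> carrier B" "a' \<in> carrier A" "b' \<in> carrier B" for a b a' b'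
  proof (intro bexI ballI)
    have C: "mult_A a a' \<in> carrier A" "mult_B b b' \<in> carrier B"
      using A.mult_bilinear B.mult_bilinear that
      by (auto simp: mv_bilinear_def mv_linear_def Pi_iff)
    then show "?p (mult_A a a') (mult_B b b') \<in> carrier T"
      by (rule pure_closed)
    fix h assume h: "h \<in> mv_hom T unit_interval_mv"
    note H = unit_hom_bimorphism[OF AB T.mv_algebra_axioms bim h]
    show "h (?p (mult_A a a') (mult_B b b')) = h (?p a b) * h (?p a' b')"
      using that C H(3) A.unit_hom_mult[OF H(1)] B.unit_hom_mult[OF H(2)] by simp
  qed
  have "\<exists>u\<in>carrier T. \<forall>h\<in>mv_hom T unit_interval_mv. h u = h s * h (?p a b)"
    if "a \<in> carrier A" "b \<in> carrier B" for a b
    using extend[OF pure_closed[OF that] s pure_pure[OF that]] by (simp add: mult.commute)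
  then show ?thesis
    by (rule extend[OF s t])
qed

section \<open>The fMV-structure on the semisimple tensor product\<close>

theorem theorem4p2:
  fixes R :: "'a mv" and mult_R :: "'a \<Rightarrow> 'a \<Rightarrow> 'a" and scal_R :: "real \<Rightarrow> 'a \<Rightarrow> 'a"
    and P :: "'b mv" and mult_P :: "'b \<Rightarrow> 'b \<Rightarrow> 'b"
  assumes "unital_fmv_algebra R mult_R scal_R" and "mv_semisimple R"
    and "unital_pmv_algebra P mult_P" and "mv_semisimple P"
  shows "mv_semisimple (ss_tensor R P) \<and>
    (\<exists>mult scal. unital_fmv_algebra (ss_tensor R P) mult scal \<and>
      (\<forall>a\<in>carrier R. \<forall>a'\<in>carrier R. \<forall>b\<in>carrier P. \<forall>b'\<in>carrier P.
         mult (ss_tensor_pure R P a b) (ss_tensor_pure R P a' b') =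
           ss_tensor_pure R P (mult_R a a') (mult_P b b')) \<and>
      (\<forall>\<alpha>\<in>{0..1}. \<forall>a\<in>carrier R. \<forall>b\<in>carrier P.
         scal \<alpha> (ss_tensor_pure R P a b) = ss_tensor_pure R P (scal_R \<alpha> a) b))"
proof -
  interpret R: unital_fmv_algebra R mult_R scal_R by (rule assms(1))
  interpret P: unital_pmv_algebra P mult_P by (rule assms(3))
  note RP = R.mv_algebra_axioms P.mv_algebra_axioms
  define T where "T = mv_tensor R P"
  interpret T: mv_algebra T
    unfolding T_def by (rule mv_tensor_universal[OF RP])
  let ?p = "mv_tensor_pure R P"
  have bim: "mv_bimorphism R P T ?p"
    unfolding T_def by (rule mv_tensor_universal[OF RP])
  note hom_pure = unit_hom_bimorphism[OF RP T.mv_algebra_axioms bim]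
  have p: "?p a b \<in> carrier T" if "a \<in> carrier R" "b \<in> carrier P" for a b
    using mv_bimorphism_closed[OF bim that] .
  have mult_closed: "mult_R a a' \<in> carrier R" if "a \<in> carrier R" "a' \<in> carrier R" for a a'
    using R.mult_bilinear that by (auto simp: mv_bilinear_def mv_linear_def Pi_iff)
  have mult_P_closed: "mult_P b b' \<in> carrier P" if "b \<in> carrier P" "b' \<in> carrier P" for b b'
    using P.mult_bilinear that by (auto simp: mv_bilinear_def mv_linear_def Pi_iff)
  \<comment> \<open>These elements have the constant value \<open>\<alpha>\<close> under all
    homomorphisms. They serve twice: as the scale for the cuts that describe the radical, and as the
    multipliers that define the scalar action.\<close>
  define \<sigma> where "\<sigma> \<alpha> = ?p (scal_R \<alpha> \<^bold>1\<^bsub>R\<^esub>) \<^bold>1\<^bsub>P\<^esub>" for \<alpha>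
  have \<sigma>: "\<sigma> \<alpha> \<in> carrier T" if "\<alpha> \<in> {0..1}" for \<alpha>
    using that unfolding \<sigma>_def by (intro p R.scal_closed R.one_closed P.one_closed)
  have hom_\<sigma>: "h (\<sigma> \<alpha>) = \<alpha>" if h: "h \<in> mv_hom T unit_interval_mv" and \<alpha>: "\<alpha> \<in> {0..1}" for h \<alpha>
    using R.unit_hom_scal[OF hom_pure(1)[OF h] R.one_closed \<alpha>] R.unit_hom_one[OF hom_pure(1)[OF h]]
    by (simp add: \<sigma>_def)
  have "mv_linear unit_interval_mv T \<sigma>"
    unfolding \<sigma>_def
  proof (rule mv_linear_compose[where f = "\<lambda>\<alpha>. scal_R \<alpha> \<^bold>1\<^bsub>R\<^esub>"])
    show "mv_linear unit_interval_mv R (\<lambda>\<alpha>. scal_R \<alpha> \<^bold>1\<^bsub>R\<^esub>)"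
      by (rule R.scal_linear[OF R.one_closed])
    show "mv_linear R T (\<lambda>a. ?p a \<^bold>1\<^bsub>P\<^esub>)"
      using bim by (simp add: mv_bimorphism_def mv_bilinear_def P.one_closed)
  qed (simp add: R.scal_closed R.one_closed unit_interval_mv_simps)
  moreover have "\<sigma> 1 = \<^bold>1\<^bsub>T\<^esub>"
    using bim by (simp add: \<sigma>_def R.scal_one R.one_closed mv_bimorphism_def)
  ultimately have rad: "mv_radical T = {x \<in> carrier T. \<forall>h\<in>mv_hom T unit_interval_mv. h x = 0}"
    by (rule T.radical_eq_common_kernel)
  define \<theta> where "\<theta> = mv_ideal_rel T (mv_radical T)"
  define N where "N = ss_tensor R P"
  have N: "N = mv_quot T \<theta>"
    by (simp add: N_def \<theta>_def T_def ss_tensor_def)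
  interpret N: separated_mv_algebra N
    unfolding N \<theta>_def by (rule T.radical_quotient_separated[OF rad])
  have pull: "(\<lambda>x. g (\<theta> `` {x})) \<in> mv_hom T unit_interval_mv" if "g \<in> mv_hom N unit_interval_mv" for g
    using T.radical_quotient_hom[OF rad] that unfolding N \<theta>_def .
  have cls: "\<theta> `` {x} \<in> carrier N" if "x \<in> carrier T" for x
    using that by (simp add: N mv_quot_carrier)
  let ?q = "ss_tensor_pure R P"
  have q: "?q a b = \<theta> `` {?p a b}" for a b
    by (simp add: ss_tensor_pure_def \<theta>_def T_def)
  have q_closed: "?q a b \<in> carrier N" if "a \<in> carrier R" "b \<in> carrier P" for a b
    unfolding q using that by (intro cls p)
  have prod: "\<exists>W. W \<in> carrier N \<and> (\<forall>g\<in>mv_hom N unit_interval_mv. g W = g U * g V)"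
    if UV: "U \<in> carrier N" "V \<in> carrier N" for U V
  proof -
    obtain s t where st: "s \<in> carrier T" "U = \<theta> `` {s}" "t \<in> carrier T" "V = \<theta> `` {t}"
      using UV unfolding N mv_quot_carrier by blast
    obtain u where u: "u \<in> carrier T" "\<forall>h\<in>mv_hom T unit_interval_mv. h u = h s * h t"
      using mv_tensor_mult_ex[OF R.unital_pmv_algebra_axioms P.unital_pmv_algebra_axioms]
        st(1,3)
      unfolding T_def by blast
    have "g (\<theta> `` {u}) = g U * g V" if "g \<in> mv_hom N unit_interval_mv" for g
      using bspec[OF u(2) pull[OF that]] st by simp
    with cls[OF u(1)] show ?thesis
      by blast
  qed
  \<comment> \<open>The choice is harmless: in \<open>N\<close> the values determine
    \<open>W\<close>. In \<open>T\<close> they would do so only modulo the radical.\<close>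
  define mul where
    "mul U V = (SOME W. W \<in> carrier N \<and> (\<forall>g\<in>mv_hom N unit_interval_mv. g W = g U * g V))" for U V
  define sc where "sc \<alpha> U = mul (\<theta> `` {\<sigma> \<alpha>}) U" for \<alpha> U
  have mul: "mul U V \<in> carrier N" "g \<in> mv_hom N unit_interval_mv \<Longrightarrow> g (mul U V) = g U * g V"
    if "U \<in> carrier N" "V \<in> carrier N" for U V g
    using someI_ex[OF prod[OF that]] unfolding mul_def by auto
  have sc: "sc \<alpha> U \<in> carrier N" "g \<in> mv_hom N unit_interval_mv \<Longrightarrow> g (sc \<alpha> U) = \<alpha> * g U"
    if "\<alpha> \<in> {0..1}" "U \<in> carrier N" for \<alpha> U g
    using that hom_\<sigma>[OF pull] by (simp_all add: sc_def mul cls \<sigma> del: atLeastAtMost_iff)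
  have fmv: "unital_fmv_algebra N mul sc"
    using mul sc by (intro N.unital_fmv_algebra_if_hom_mult) auto
  have mul_pure: "mul (?q a b) (?q a' b') = ?q (mult_R a a') (mult_P b b')"
    if "a \<in> carrier R" "a' \<in> carrier R" "b \<in> carrier P" "b' \<in> carrier P" for a a' b b'
  proof (rule N.sep)
    fix g assume g: "g \<in> mv_hom N unit_interval_mv"
    note H = hom_pure[OF pull[OF g]]
    show "g (mul (?q a b) (?q a' b')) = g (?q (mult_R a a') (mult_P b b'))"
      using that mul(2)[OF q_closed q_closed g] H(3) mult_closed mult_P_closed
        R.unit_hom_mult[OF H(1)] P.unit_hom_mult[OF H(2)]
      by (simp add: q)
  qed (use that in \<open>simp_all add: mul q_closed mult_closed mult_P_closed\<close>)
  have sc_pure: "sc \<alpha> (?q a b) = ?q (scal_R \<alpha> a) b"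
    if "\<alpha> \<in> {0..1}" "a \<in> carrier R" "b \<in> carrier P" for \<alpha> a b
  proof (rule N.sep)
    fix g assume g: "g \<in> mv_hom N unit_interval_mv"
    note H = hom_pure[OF pull[OF g]]
    have "g (sc \<alpha> (?q a b)) = \<alpha> * g (?q a b)"
      using that g by (intro sc q_closed)
    then show "g (sc \<alpha> (?q a b)) = g (?q (scal_R \<alpha> a) b)"
      using H(3)[OF that(2,3)] H(3)[OF R.scal_closed[OF that(1,2)] that(3)]
        R.unit_hom_scal[OF H(1) that(2,1)]
      by (simp add: q)
  qed (use that in \<open>simp_all add: sc q_closed R.scal_closed\<close>)
  show ?thesis
    using N.semisimple fmv mul_pure sc_pure unfolding N_def by blast
qed

end
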